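(* Let $p,q\in\mathbb{N}$. Then for every $\tau\in\mathbb{C}$ with $\operatorname{Im}(\tau)>0$, \begin{align*} \widetilde{G}_{2p,2q}(\tau) &= G_{2(p+q)}(\tau) \\ &\quad + \sum_{\substack{l_1,l_2\in \mathbb{N}\\ l_1 + l_2 = p+q}} \left( \frac{2 \zeta(2l_2) \binom{2l_2-1}{2q-1} }{\tau^{2l_2}}\, G_{2l_1}(\tau) + \frac{2 \zeta(2l_1) \binom{2l_1-1}{2p-1} }{\tau^{2l_1}}\, G_{2l_2}(\tau) \right) \\ &\quad + \frac{4}{\tau^{2(p+q)}}\Bigg[ \zeta(2p) \zeta(2q) - \frac{1}{2} \zeta(2(p+q)) - \sum_{\substack{l_1,l_2\in \mathbb{N}\\ l_1 + l_2 = p+q}}\zeta(2l_1)\zeta(2l_2) \left( \binom{2l_2-1}{2q-1} + \binom{2l_1-1}{2p-1} \right) \Bigg]. \end{align*} In particular, $\tau^{2(p+q)}\, \widetilde{G}_{2p,2q}(\tau) \in \mathbb{Q}\left[ \tau^2, \pi^2, G_2(\tau), G_4(\tau), G_6(\tau) \right]$.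
   Context: $\mathbb{N}=\{1,2,3,\dots\}$, $\zeta$ is the Riemann zeta-function, and $\binom{a}{b}=0$ for integers $0\le a<b$. For $\tau\in\mathbb{C}$ with $\operatorname{Im}(\tau)>0$ and $j\in\mathbb{N}$, the Eisenstein series is $$G_{2j}(\tau)=\sum_{m\in\mathbb{Z}}\ \sum_{\substack{n\in\mathbb{Z}\\ (m,n)\neq(0,0)}}\frac{1}{(m+n\tau)^{2j}}.$$ For $j\ge 2$ this converges absolutely. For $j=1$ it is conditionally convergent and is taken in the indicated order: inner sum over $n$, outer sum over $m$, where $n$ is the coefficient of $\tau$. (This differs from the usual $G_2$, in which the inner sum runs over the integer not multiplied by $\tau$.) For $p,q\in\mathbb{N}$, $$\widetilde{G}_{2p,2q}(\tau)=\sum_{m\in\mathbb{Z}}\ \sum_{\substack{n_1\in\mathbb{Z}\\ (m,n_1)\neq(0,0)}}\ \sum_{\substack{n_2\in\mathbb{Z}\\ (m,n_2)\neq(0,0)}}\frac{1}{(m+n_1\tau)^{2p}(m+n_2\tau)^{2q}},$$ with the summation taken in the indicated order (outer sum over $m$). $\mathbb{Q}[\tau^2,\pi^2,G_2(\tau),G_4(\tau),G_6(\tau)]$ denotes the set of polynomial expressions with rational coefficients in the listed quantities, viewed as functions of $\tau$. *)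

theory Defs
  imports "HOL-Analysis.Analysis"
begin

definition upper_half_plane :: "complex set" where
  "upper_half_plane = {\<tau>. Im \<tau> > 0}"

text \<open>
  The Riemann zeta-function, only at integers \<open>k \<ge> 2\<close>, where it is given by its
  Dirichlet series.
\<close>

definition zeta_at :: "nat \<Rightarrow> complex" where
  "zeta_at k = (\<Sum>n. 1 / of_nat (Suc n) ^ k)"

text \<open>
  Both series are indexed by their weights, so that \<open>eisenstein_G (2 * j)\<close> is $G_{2j}$ and
  \<open>double_G (2 * p) (2 * q)\<close> is $\widetilde{G}_{2p,2q}$.
  The order of summation is encoded by iterating \<open>infsum\<close>. For \<open>Im \<tau> > 0\<close> and positive even
  weights each single sum, with the inner ones already evaluated, converges absolutely, so
  \<open>infsum\<close> never takes its default value there.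
  In \<open>eisenstein_G\<close> the inner variable \<open>n\<close> is the coefficient of \<open>\<tau>\<close>;
  in weight 2 this is not the usual $G_2$, whose sums are in the opposite order.
\<close>

definition eisenstein_G :: "nat \<Rightarrow> complex \<Rightarrow> complex" where
  "eisenstein_G k \<tau> =
     (\<Sum>\<^sub>\<infinity>m\<in>(UNIV :: int set). \<Sum>\<^sub>\<infinity>n\<in>{n :: int. (m, n) \<noteq> (0, 0)}.
        1 / (of_int m + of_int n * \<tau>) ^ k)"

definition double_G :: "nat \<Rightarrow> nat \<Rightarrow> complex \<Rightarrow> complex" where
  "double_G a b \<tau> =
     (\<Sum>\<^sub>\<infinity>m\<in>(UNIV :: int set).
        \<Sum>\<^sub>\<infinity>n\<^sub>1\<in>{n :: int. (m, n) \<noteq> (0, 0)}. \<Sum>\<^sub>\<infinity>n\<^sub>2\<in>{n :: int. (m, n) \<noteq> (0, 0)}.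
          1 / ((of_int m + of_int n\<^sub>1 * \<tau>) ^ a * (of_int m + of_int n\<^sub>2 * \<tau>) ^ b))"

text \<open>
  Polynomial expressions with rational coefficients in a set \<open>A\<close> of functions. Functions are
  total in HOL, so \<open>rat_polys_on S A\<close> identifies them with their restrictions to \<open>S\<close>.
\<close>

inductive_set rat_polys :: "('a \<Rightarrow> complex) set \<Rightarrow> ('a \<Rightarrow> complex) set"
  for A :: "('a \<Rightarrow> complex) set" where
  const: "(\<lambda>_. of_rat c) \<in> rat_polys A"
| gen: "f \<in> A \<Longrightarrow> f \<in> rat_polys A"
| add: "f \<in> rat_polys A \<Longrightarrow> g \<in> rat_polys A \<Longrightarrow> (\<lambda>x. f x + g x) \<in> rat_polys A"
| mult: "f \<in> rat_polys A \<Longrightarrow> g \<in> rat_polys A \<Longrightarrow> (\<lambda>x. f x * g x) \<in> rat_polys A"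

definition rat_polys_on :: "'a set \<Rightarrow> ('a \<Rightarrow> complex) set \<Rightarrow> ('a \<Rightarrow> complex) set" where
  "rat_polys_on S A = {f. \<exists>g\<in>rat_polys A. \<forall>x\<in>S. f x = g x}"

end

theory Submission
  imports Defs
begin

text \<open>
  Partial fractions turn a product \<open>u\<^sup>-\<^sup>a v\<^sup>-\<^sup>b\<close> into a combination of the products
  \<open>(v - u)\<^sup>-\<^sup>h u\<^sup>-\<^sup>l\<close> and \<open>(v - u)\<^sup>-\<^sup>h v\<^sup>-\<^sup>l\<close> with \<open>h + l = a + b\<close>. Summing over \<open>u, v \<in> y + \<int>\<close>, where the
  terms with \<open>l = 1\<close> telescope to 0, expresses the product of two sums \<open>\<Sum>n. (y + n)\<^sup>-\<^sup>k\<close> through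
  such sums and zeta values. For \<open>y = m / \<tau>\<close> this is the row \<open>m\<close> of the double series, so that
  summing over \<open>m\<close> gives the formula; the constant term is identified by the case \<open>y = 0\<close>,
  which also yields a recursion for the even zeta values.

  The same partial fractions, summed over pairs of lattice points, give recursions for the
  Eisenstein series. A combination of \<open>G\<^sub>3 G\<^sub>N\<^sub>-\<^sub>3\<close>, \<open>G\<^sub>4 G\<^sub>N\<^sub>-\<^sub>4\<close> and \<open>G\<^sub>5 G\<^sub>N\<^sub>-\<^sub>5\<close> avoids the terms of weight
  1 and 2, which do not converge absolutely, and expresses \<open>G\<^sub>N\<close> for even \<open>N \<ge> 8\<close> through
  series of lower weight.
\<close>

section \<open>Partial fractions\<close>

text \<open>Intended for \<open>s = 1 / u\<close>, \<open>t = 1 / v\<close> and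
  \<open>e = 1 / (v - u)\<close>. With three independent arguments this is a polynomial, so it can
  also be evaluated where one of them is \<open>inverse 0 = 0\<close>.\<close>

definition pf_sum :: "nat \<Rightarrow> nat \<Rightarrow> complex \<Rightarrow> complex \<Rightarrow> complex \<Rightarrow> complex" where
  "pf_sum a b s t e =
     (\<Sum>l=1..<a + b. e ^ (a + b - l) *
        ((-1) ^ (a + l) * of_nat ((a + b - l - 1) choose (b - 1)) * s ^ l
         + (-1) ^ a * of_nat ((a + b - l - 1) choose (a - 1)) * t ^ l))"

text \<open>Exchanging \<open>u\<close> and \<open>v\<close> negates \<open>v - u\<close> and hence
  \<open>e\<close>; the summands then agree one by one.\<close>

lemma pf_sum_swap: "pf_sum a b s t e = pf_sum b a t s (- e)"
  unfolding pf_sum_def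
proof (rule sum.cong)
  show "{1..<a + b} = {1..<b + a}" by (simp add: add.commute)
next
  fix l assume l: "l \<in> {1..<b + a}"
  \<comment> \<open>The sign produced by \<open>(- e) ^ (a + b - l)\<close>: the exponents
    \<open>a + b + l\<close> and \<open>a + b - l\<close> have the same parity.\<close>
  define \<sigma> :: complex where "\<sigma> = (-1) ^ (a + b + l)"
  have signs: "(-1) ^ (b + l) = \<sigma> * (-1) ^ a" "(-1) ^ b = \<sigma> * (-1) ^ (a + l)" "\<sigma> * \<sigma> = 1"
    by (simp_all add: \<sigma>_def minus_one_power_iff)
  have "a + b + l = (b + a - l) + 2 * l" using l by auto
  hence "\<sigma> = (-1) ^ (b + a - l)"
    unfolding \<sigma>_def by (metis minus_one_power_iff even_add even_mult_iff even_numeral)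
  hence neg: "(- e) ^ (b + a - l) = \<sigma> * e ^ (a + b - l)"
    by (simp add: power_minus[of e] add.commute)
  have factor: "(\<sigma> * E) * (\<sigma> * q * c * Y + \<sigma> * p * d * X) = E * (p * d * X + q * c * Y)"
    for E p q X Y c d
  proof -
    have "(\<sigma> * E) * (\<sigma> * q * c * Y + \<sigma> * p * d * X) = (\<sigma> * \<sigma>) * (E * (p * d * X + q * c * Y))"
      by (simp only: algebra_simps)
    thus ?thesis by (simp only: signs(3) mult_1_left)
  qed
  show "e ^ (a + b - l) *
      ((-1) ^ (a + l) * of_nat ((a + b - l - 1) choose (b - 1)) * s ^ l
       + (-1) ^ a * of_nat ((a + b - l - 1) choose (a - 1)) * t ^ l)
    = (- e) ^ (b + a - l) *
      ((-1) ^ (b + l) * of_nat ((b + a - l - 1) choose (a - 1)) * t ^ l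
       + (-1) ^ b * of_nat ((b + a - l - 1) choose (b - 1)) * s ^ l)"
    unfolding neg signs(1) signs(2) factor by (simp only: add.commute[of b a])
qed

text \<open>Induction on \<open>b\<close>: multiplying by \<open>t\<close> and replacing
  \<open>s * t\<close> by \<open>e * (s - t)\<close> splits off one pure power of \<open>t\<close>
  each time.\<close>

lemma partial_fraction_1:
  fixes s t e :: complex
  assumes "s * t = e * (s - t)" and "b \<ge> 1"
  shows "s * t ^ b = pf_sum 1 b s t e"
proof -
  have "s * t ^ b = e ^ b * s - (\<Sum>l=1..b. e ^ (Suc b - l) * t ^ l)"
    using assms(2)
  proof (induction b rule: dec_induct)
    case base
    then show ?case using assms(1) by (simp add: algebra_simps)
  next
    case (step b)
    have "s * t ^ Suc b = (s * t) * t ^ b" by simp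
    also have "\<dots> = e * (s * t ^ b) - e * t ^ Suc b"
      unfolding assms(1) by (simp add: algebra_simps)
    also have "\<dots> = e ^ Suc b * s - (\<Sum>l=1..b. e * e ^ (Suc b - l) * t ^ l) - e * t ^ Suc b"
      by (simp only: step.IH) (simp add: algebra_simps sum_distrib_left)
    also have "(\<Sum>l=1..b. e * e ^ (Suc b - l) * t ^ l) = (\<Sum>l=1..b. e ^ (Suc (Suc b) - l) * t ^ l)"
      by (intro sum.cong) (auto simp: Suc_diff_le)
    finally show ?case by simp
  qed
  also have "\<dots> = pf_sum 1 b s t e"
  proof -
    \<comment> \<open>For \<open>a = 1\<close> the coefficient of \<open>s ^ l\<close> contains
      \<open>(b - l) choose (b - 1)\<close>, which survives only at \<open>l = 1\<close>.\<close>
    have "(\<Sum>l=1..<1 + b. e ^ (1 + b - l) * ((-1) ^ (1 + l) * of_nat ((1 + b - l - 1) choose (b - 1)) * s ^ l))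
       = (\<Sum>l\<in>{1}. e ^ (1 + b - l) * ((-1) ^ (1 + l) * of_nat ((1 + b - l - 1) choose (b - 1)) * s ^ l))"
      by (rule sum.mono_neutral_right) (use assms(2) in auto)
    also have "\<dots> = e ^ b * s" by simp
    finally show ?thesis
      by (simp add: pf_sum_def distrib_left right_diff_distrib sum_subtractf sum.distrib sum_negf
          atLeastLessThanSuc_atLeastAtMost)
  qed
  finally show ?thesis .
qed

text \<open>Replacing one factor \<open>s * t\<close> by \<open>e * (s - t)\<close> leads to two
  products of total weight \<open>a + b - 1\<close>, whose coefficients combine by Pascal's
  rule.\<close>

theorem partial_fraction:
  fixes s t e :: complex
  assumes "s * t = e * (s - t)" and "a \<ge> 1" and "b \<ge> 1"
  shows "s ^ a * t ^ b = pf_sum a b s t e"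
  using assms(2,3)
proof (induction "a + b" arbitrary: a b rule: less_induct)
  case less
  consider "a = 1" | "b = 1" | "a \<ge> 2" "b \<ge> 2" using less.prems by linarith
  then show ?case
  proof cases
    case 1
    then show ?thesis using partial_fraction_1[OF assms(1)] less.prems by simp
  next
    case 2
    have "t * s ^ a = pf_sum 1 a t s (- e)"
      by (rule partial_fraction_1) (use assms(1) less.prems in \<open>auto simp: algebra_simps\<close>)
    then show ?thesis using 2 pf_sum_swap[of a 1 s t e] by (simp add: mult.commute)
  next
    case 3
    define a' b' where "a' = a - 2" and "b' = b - 2"
    have ab: "a = Suc (Suc a')" "b = Suc (Suc b')"
      using 3 by (simp_all add: a'_def b'_def)
    define N where "N = a + b - 1"
    have N: "Suc a' + b = N" "a + Suc b' = N" "a + b = Suc N" "N \<ge> 3" by (auto simp: N_def ab)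
    have "s ^ a * t ^ b = s ^ Suc a' * t ^ Suc b' * (s * t)"
      by (simp add: ab)
    also have "\<dots> = e * (s ^ a * t ^ Suc b') - e * (s ^ Suc a' * t ^ b)"
      unfolding assms(1) by (simp add: ab algebra_simps)
    also have "\<dots> = e * pf_sum a (Suc b') s t e - e * pf_sum (Suc a') b s t e"
      using less.hyps[of a "Suc b'"] less.hyps[of "Suc a'" b] by (simp add: ab)
    also have "\<dots> = (\<Sum>l=1..<N. e ^ (Suc N - l) *
        ((-1) ^ (a + l) * of_nat ((Suc N - l - 1) choose (b - 1)) * s ^ l
         + (-1) ^ a * of_nat ((Suc N - l - 1) choose (a - 1)) * t ^ l))"
      unfolding pf_sum_def N sum_distrib_left sum_subtractf[symmetric]
    proof (rule sum.cong, goal_cases)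
      case (2 l)
      \<comment> \<open>With \<open>N = l + k + 1\<close> the upper entries of the binomials are
        \<open>k\<close> and \<open>k + 1\<close>, and Pascal's rule applies without truncated
        subtraction.\<close>
      then obtain k where k: "N = Suc (l + k)" by (auto dest: less_imp_Suc_add)
      show ?case by (simp add: k ab algebra_simps)
    qed simp
    \<comment> \<open>The additional index \<open>l = N\<close> contributes nothing, since
      \<open>0 choose (a - 1)\<close> and \<open>0 choose (b - 1)\<close> vanish for
      \<open>a, b \<ge> 2\<close>.\<close>
    also have "\<dots> = pf_sum a b s t e"
      unfolding pf_sum_def N using \<open>N \<ge> 3\<close> by (simp add: ab)
    finally show ?thesis .
  qed
qed

section \<open>Evaluation of the decomposition at its poles\<close>

lemma sum_choose_rev:
  assumes "c \<ge> 1"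
  shows "(\<Sum>l=1..<n. (n - l - 1) choose (c - 1)) = (n - 1) choose c"
proof (cases n)
  case (Suc m)
  \<comment> \<open>Reversing the order of summation gives the hockey-stick identity.\<close>
  have "(\<Sum>l=1..<n. (n - l - 1) choose (c - 1)) = (\<Sum>k<m. k choose (c - 1))"
    by (rule sum.reindex_bij_witness[of _ "\<lambda>k. m - k" "\<lambda>l. m - l"]) (auto simp: Suc)
  also have "\<dots> = m choose c"
    using assms sum_choose_upper[of "c - 1" "m - 1"] by (cases m) (simp_all add: lessThan_Suc_atMost)
  finally show ?thesis by (simp add: Suc)
qed (use assms in auto)

text \<open>The case \<open>u = 0\<close>, where \<open>inverse u = 0\<close> and
  \<open>e = inverse v\<close>: all powers of \<open>e\<close> merge and the hockey-stick identity
  adds up the coefficients.\<close>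

lemma pf_sum_0_left:
  assumes "a \<ge> 1"
  shows "pf_sum a b 0 e e = (-1) ^ a * of_nat ((a + b - 1) choose a) * e ^ (a + b)"
proof -
  have "pf_sum a b 0 e e = (\<Sum>l=1..<a + b. (-1) ^ a * e ^ (a + b) * of_nat ((a + b - l - 1) choose (a - 1)))"
    unfolding pf_sum_def
  proof (rule sum.cong, goal_cases)
    case (2 l)
    have "e ^ (a + b) = e ^ (a + b - l) * e ^ l" using 2 by (simp flip: power_add)
    thus ?case using 2 by (simp add: algebra_simps)
  qed simp
  also have "\<dots> = (-1) ^ a * e ^ (a + b) * of_nat (\<Sum>l=1..<a + b. (a + b - l - 1) choose (a - 1))"
    by (simp only: of_nat_sum sum_distrib_left)
  finally show ?thesis by (simp only: sum_choose_rev[OF assms]) simp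
qed

lemma pf_sum_0_right:
  assumes "b \<ge> 1"
  shows "pf_sum a b (- e) 0 e = (-1) ^ a * of_nat ((a + b - 1) choose b) * e ^ (a + b)"
proof -
  have "(- e) ^ (a + b) = (-1) ^ (a + b) * e ^ (a + b)" by (rule power_minus)
  moreover have "(-1::complex) ^ b * (-1) ^ (a + b) = (-1) ^ a" by (simp add: minus_one_power_iff)
  moreover have "pf_sum a b (- e) 0 e = (-1) ^ b * of_nat ((a + b - 1) choose b) * (- e) ^ (a + b)"
    using pf_sum_swap[of a b "- e" 0 e] pf_sum_0_left[OF assms, of a "- e"] by (simp add: add.commute)
  ultimately show ?thesis by (metis (no_types, lifting) mult.assoc mult.commute)
qed

lemma pf_sum_0: "pf_sum a b s t 0 = 0"
  unfolding pf_sum_def by (rule sum.neutral) (auto simp: power_0_left)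

text \<open>Since \<open>inverse 0 = 0\<close>, the partial fraction decomposition extends to the poles and to the
  diagonal at the price of the correction terms below.\<close>

lemma partial_fraction_inverse:
  fixes u v :: complex
  assumes "a \<ge> 1" and "b \<ge> 1"
  defines "e \<equiv> inverse (v - u)"
  shows "inverse u ^ a * inverse v ^ b =
    pf_sum a b (inverse u) (inverse v) e
    + (if u = v then inverse u ^ (a + b) else 0)
    - (if u = 0 then (-1) ^ a * of_nat ((a + b - 1) choose a) * e ^ (a + b) else 0)
    - (if v = 0 then (-1) ^ a * of_nat ((a + b - 1) choose b) * e ^ (a + b) else 0)"
proof -
  consider "u = v" | "u \<noteq> v" "u = 0" | "u \<noteq> v" "v = 0" | "u \<noteq> v" "u \<noteq> 0" "v \<noteq> 0" by blast
  then show ?thesis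
  proof cases
    case 1
    then show ?thesis using assms by (auto simp: e_def pf_sum_0 power_add power_0_left)
  next
    case 2
    then show ?thesis using assms by (simp add: e_def pf_sum_0_left)
  next
    case 3
    have "inverse u = - e" using 3 by (simp add: e_def)
    then show ?thesis using 3 assms(1,2) by (simp add: pf_sum_0_right)
  next
    case 4
    then have "inverse u * inverse v = e * (inverse u - inverse v)"
      by (simp add: e_def field_simps)
    from partial_fraction[OF this assms(1,2)] 4 show ?thesis by simp
  qed
qed

section \<open>Summation over abelian groups and the integers\<close>

lemma has_sum_sum:
  fixes f :: "'i \<Rightarrow> 'a \<Rightarrow> complex"
  assumes "\<And>i. i \<in> I \<Longrightarrow> (f i has_sum s i) A"
  shows "((\<lambda>x. \<Sum>i\<in>I. f i x) has_sum (\<Sum>i\<in>I. s i)) A"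
  using assms
proof (induction I rule: infinite_finite_induct)
  case (insert i I)
  then show ?case by (simp add: has_sum_add)
qed simp_all

lemma has_sum_diff:
  fixes f g :: "'a \<Rightarrow> complex"
  assumes "(f has_sum a) A" and "(g has_sum b) A"
  shows "((\<lambda>x. f x - g x) has_sum (a - b)) A"
  using has_sum_add[OF assms(1) has_sum_uminusI[OF assms(2)]] by simp

lemma has_sum_shift:
  fixes f :: "'a::ab_group_add \<Rightarrow> complex"
  assumes "(f has_sum S) UNIV"
  shows "((\<lambda>x. f (x + d)) has_sum S) UNIV"
  using assms by (subst (asm) has_sum_reindex_bij_witness[of UNIV "\<lambda>x. x - d" "\<lambda>x. x + d" UNIV, symmetric]) auto

lemma has_sum_indicator:
  fixes c :: complex
  shows "((\<lambda>x. if x = x0 then c else 0) has_sum c) UNIV"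
  by (rule has_sum_finite_neutralI[of "{x0}"]) auto

text \<open>For complex families summability is absolute, so the product family is summable and may
  be summed iteratively.\<close>

lemma has_sum_times:
  fixes f :: "'a \<Rightarrow> complex" and g :: "'b \<Rightarrow> complex"
  assumes "(f has_sum a) A" and "(g has_sum b) B"
  shows "((\<lambda>(x, y). f x * g y) has_sum (a * b)) (A \<times> B)"
proof -
  have f: "(\<lambda>u. norm (f u)) summable_on A" and g: "(\<lambda>u. norm (g u)) summable_on B"
    using assms summable_on_iff_abs_summable_on_complex has_sum_imp_summable by blast+
  have "(\<lambda>(x, y). f x * g y) summable_on (A \<times> B)"
    unfolding summable_on_iff_abs_summable_on_complex Infinite_Sum.abs_summable_on_Sigma_iff
    using f g by (auto simp: norm_mult infsum_cmult_right' infsum_nonneg abs_mult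
        intro!: summable_on_cmult_right summable_on_cmult_left)
  moreover have "((\<lambda>y. f x * g y) has_sum (f x * b)) B" for x
    by (intro has_sum_cmult_right assms)
  moreover have "((\<lambda>x. f x * b) has_sum (a * b)) A"
    by (intro has_sum_cmult_left assms)
  ultimately show ?thesis
    by (intro has_sum_SigmaI) auto
qed

text \<open>The substitution \<open>v = u + d\<close>; it handles the terms with a power of
  \<open>1 / d\<close> and a power of \<open>1 / v\<close>.\<close>

lemma has_sum_times_shift:
  fixes f g :: "'a::ab_group_add \<Rightarrow> complex"
  assumes "(f has_sum a) UNIV" and "(g has_sum b) UNIV"
  shows "((\<lambda>(d, u). f d * g (u + d)) has_sum (a * b)) (UNIV \<times> UNIV)"
  using has_sum_times[OF assms]
  by (subst has_sum_reindex_bij_witness[of _ "\<lambda>(d, v). (d, v - d)" "\<lambda>(d, u). (d, u + d)"]) auto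

text \<open>Sorts the pairs \<open>(u, v)\<close> by their difference \<open>d = v - u\<close>, the
  quantity inverted in the partial fractions.\<close>

lemma has_sum_convolution:
  fixes f g :: "'a::ab_group_add \<Rightarrow> complex"
  assumes "(f has_sum a) UNIV" and "(g has_sum b) UNIV"
  shows "((\<lambda>(d, u). f u * g (u + d)) has_sum (a * b)) (UNIV \<times> UNIV)"
  using has_sum_times[OF assms]
  by (subst has_sum_reindex_bij_witness[of _ "\<lambda>(u, v). (v - u, u)" "\<lambda>(d, u). (u, u + d)"]) auto

section \<open>Absolute convergence over the integers\<close>

lemma summable_on_int_even:
  fixes f :: "nat \<Rightarrow> real"
  assumes "summable f" and "\<And>n. f n \<ge> 0"
  shows "(\<lambda>n::int. f (nat \<bar>n\<bar>)) summable_on UNIV"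
proof -
  have f: "f summable_on UNIV"
    by (rule summable_nonneg_imp_summable_on) (use assms in auto)
  have "(\<lambda>n::int. f (nat \<bar>n\<bar>)) summable_on (range int)"
    by (subst summable_on_reindex) (use f in \<open>auto simp: o_def\<close>)
  moreover have "(\<lambda>n::int. f (nat \<bar>n\<bar>)) summable_on (range (\<lambda>n. - int n))"
    by (subst summable_on_reindex) (use f in \<open>auto simp: o_def inj_on_def\<close>)
  moreover have "(UNIV::int set) = range int \<union> range (\<lambda>n. - int n)"
    by (auto simp: image_iff) (metis int_cases2)
  ultimately show ?thesis using summable_on_union by metis
qed

lemma summable_on_int_powr:
  assumes "p > 1"
  shows "(\<lambda>n::int. (1 + \<bar>real_of_int n\<bar>) powr (- p)) summable_on UNIV"
proof -
  have "summable (\<lambda>n. real (Suc n) powr (- p))"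
    using assms by (subst summable_Suc_iff) (simp add: summable_real_powr_iff)
  from summable_on_int_even[OF this] show ?thesis
    by (simp add: add.commute)
qed

text \<open>Far from the origin \<open>y + n\<close> is comparable to
  \<open>1 + \<bar>n\<bar>\<close>; the finitely many other \<open>n\<close>, including a possible
  pole, are absorbed into the constant.\<close>

lemma inverse_shift_bound:
  fixes y :: complex
  obtains C where "C > 0" "\<And>n::int. norm (inverse (y + of_int n)) \<le> C / (1 + \<bar>real_of_int n\<bar>)"
proof -
  define F where "F = {n::int. \<bar>real_of_int n\<bar> < 2 * norm y + 1}"
  have "F \<subseteq> {- \<lceil>2 * norm y + 1\<rceil>..\<lceil>2 * norm y + 1\<rceil>}"
    unfolding F_def by (auto simp: abs_less_iff) linarith+
  hence fin: "finite F" by (rule finite_subset) simp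
  define g where "g n = norm (inverse (y + of_int n)) * (1 + \<bar>real_of_int n\<bar>)" for n :: int
  have g0: "g n \<ge> 0" for n by (simp add: g_def)
  \<comment> \<open>The sum over \<open>F\<close> is a crude bound for its largest term; the 4 takes
    care of all \<open>n\<close> outside \<open>F\<close>.\<close>
  have "g n \<le> 4 + sum g F" for n
  proof (cases "n \<in> F")
    case True
    from member_le_sum[OF this _ fin, of g] g0 show ?thesis by simp
  next
    case False
    hence n: "\<bar>real_of_int n\<bar> \<ge> 2 * norm y + 1" by (simp add: F_def)
    have "norm (of_int n :: complex) \<le> norm (y + of_int n) + norm y"
      using norm_triangle_ineq4[of "y + of_int n" y] by simp
    hence "1 + \<bar>real_of_int n\<bar> \<le> 4 * norm (y + of_int n)" using n by simp
    moreover from this have "norm (y + of_int n) > 0" by linarith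
    moreover have "g n = (1 + \<bar>real_of_int n\<bar>) / norm (y + of_int n)"
      by (simp add: g_def norm_inverse divide_inverse)
    ultimately have "g n \<le> 4" by (simp only: pos_divide_le_eq)
    thus ?thesis using sum_nonneg[of F g] g0 by simp
  qed
  moreover have "4 + sum g F > 0" using sum_nonneg[of F g] g0 by (simp add: add_pos_nonneg)
  ultimately show ?thesis
    by (intro that[of "4 + sum g F"]) (auto simp: g_def field_simps)
qed

text \<open>Two different shifts are allowed because \<open>z = y\<close> gives the squares and
  \<open>z = y + 1\<close> the terms of the telescoping series.\<close>

lemma summable_inverse_shift_mult:
  fixes y z :: complex
  shows "(\<lambda>n::int. inverse (y + of_int n) * inverse (z + of_int n)) summable_on UNIV"
proof -
  obtain C where C: "C > 0" "\<And>n::int. norm (inverse (y + of_int n)) \<le> C / (1 + \<bar>real_of_int n\<bar>)"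
    using inverse_shift_bound by blast
  obtain D where D: "D > 0" "\<And>n::int. norm (inverse (z + of_int n)) \<le> D / (1 + \<bar>real_of_int n\<bar>)"
    using inverse_shift_bound by blast
  have "(\<lambda>n::int. C * D * (1 + \<bar>real_of_int n\<bar>) powr (- 2)) summable_on UNIV"
    by (intro summable_on_cmult_right summable_on_int_powr) simp
  thus ?thesis unfolding summable_on_iff_abs_summable_on_complex
  proof (rule Infinite_Sum.abs_summable_on_comparison_test')
    fix n :: int
    have "norm (inverse (y + of_int n) * inverse (z + of_int n))
        \<le> (C / (1 + \<bar>real_of_int n\<bar>)) * (D / (1 + \<bar>real_of_int n\<bar>))"
      unfolding norm_mult by (intro mult_mono C D) (use C(1) in auto)
    also have "\<dots> = C * D * (1 + \<bar>real_of_int n\<bar>) powr (- 2)"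
      by (simp add: powr_minus powr_numeral power2_eq_square field_simps)
    finally show "norm (inverse (y + of_int n) * inverse (z + of_int n))
        \<le> C * D * (1 + \<bar>real_of_int n\<bar>) powr (- 2)" .
  qed
qed

lemma summable_on_mult_bounded:
  fixes f g :: "'a \<Rightarrow> complex"
  assumes "f summable_on A" and "\<And>x. x \<in> A \<Longrightarrow> norm (g x) \<le> C"
  shows "(\<lambda>x. f x * g x) summable_on A"
proof -
  have "(\<lambda>x. norm (f x) * C) summable_on A"
    using assms(1) unfolding summable_on_iff_abs_summable_on_complex by (rule summable_on_cmult_left)
  thus ?thesis unfolding summable_on_iff_abs_summable_on_complex
    by (rule Infinite_Sum.abs_summable_on_comparison_test') (use assms(2) in \<open>auto simp: norm_mult intro!: mult_left_mono\<close>)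
qed

lemma summable_inverse_shift_power:
  fixes y :: complex
  assumes "k \<ge> 2"
  shows "(\<lambda>n::int. inverse (y + of_int n) ^ k) summable_on UNIV"
  using assms
proof (induction k rule: dec_induct)
  case base
  show ?case using summable_inverse_shift_mult[of y y] by (simp add: power2_eq_square)
next
  case (step k)
  obtain C where C: "C > 0" "\<And>n::int. norm (inverse (y + of_int n)) \<le> C / (1 + \<bar>real_of_int n\<bar>)"
    using inverse_shift_bound by blast
  have "norm (inverse (y + of_int n)) \<le> C" for n
    by (rule order_trans[OF C(2)]) (use C(1) in \<open>simp add: field_simps\<close>)
  from summable_on_mult_bounded[OF step.IH this] show ?case by (simp add: mult.commute)
qed

text \<open>For \<open>d = 1\<close> the terms agree with \<open>1 / ((y + n) (y + n + 1))\<close>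
  away from the poles, so the series converges absolutely and its value is the limit of symmetric
  partial sums. These collapse to two boundary terms tending to 0. Other \<open>d\<close> follow by
  adding shifted copies.\<close>

lemma has_sum_telescope:
  fixes y :: complex and d :: int
  shows "((\<lambda>n::int. inverse (y + of_int n) - inverse (y + of_int (n + d))) has_sum 0) UNIV"
proof -
  define f where "f n = inverse (y + of_int n)" for n :: int
  have step: "((\<lambda>n. f n - f (n + 1)) has_sum 0) UNIV"
  proof -
    have fin: "finite {n::int. z + of_int n = 0}" for z :: complex
    proof (rule finite_subset)
      show "{n::int. z + of_int n = 0} \<subseteq> {- \<lfloor>Re z\<rfloor>}"
      proof clarify
        fix n :: int assume "z + of_int n = 0"
        hence "Re z = of_int (- n)" by (simp add: complex_eq_iff)
        thus "n = - \<lfloor>Re z\<rfloor>" by simp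
      qed
    qed simp
    have fin': "finite {n::int. y + of_int (n + 1) = 0}"
      using fin[of "y + 1"] by (simp add: add_ac)
    have "(\<lambda>n. inverse (y + of_int n) * inverse (y + 1 + of_int n)) summable_on UNIV"
      by (rule summable_inverse_shift_mult)
    hence "(\<lambda>n. f n - f (n + 1)) summable_on (UNIV - ({n. y + of_int n = 0} \<union> {n. y + of_int (n + 1) = 0}))"
      by (rule summable_on_subset[THEN summable_on_cong[THEN iffD1, rotated]])
        (auto simp: f_def field_simps)
    moreover have "(\<lambda>n. f n - f (n + 1)) summable_on ({n. y + of_int n = 0} \<union> {n. y + of_int (n + 1) = 0})"
      using fin[of y] fin' by (intro summable_on_finite) blast
    ultimately have "(\<lambda>n. f n - f (n + 1)) summable_on UNIV"
      using summable_on_union by fastforce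
    then obtain S where S: "((\<lambda>n. f n - f (n + 1)) has_sum S) UNIV"
      by (auto simp: summable_on_def)
    \<comment> \<open>These intervals exhaust the integers, so the limit over finite sets can be
      computed along them.\<close>
    have lim: "filterlim (\<lambda>N. {- int N..<int N}) (finite_subsets_at_top UNIV) sequentially"
      unfolding filterlim_finite_subsets_at_top
    proof (intro allI impI, elim conjE)
      fix X :: "int set" assume X: "finite X"
      define M where "M = Suc (nat (Max (insert 0 (abs ` X))))"
      have "\<bar>x\<bar> < int M" if "x \<in> X" for x
      proof -
        have "\<bar>x\<bar> \<le> Max (insert 0 (abs ` X))" using X that by (intro Max_ge) auto
        thus ?thesis unfolding M_def by arith
      qed
      hence "X \<subseteq> {- int N..<int N}" if "N \<ge> M" for N using that by fastforce
      thus "\<forall>\<^sub>F N in sequentially. finite {- int N..<int N} \<and> X \<subseteq> {- int N..<int N} \<and> {- int N..<int N} \<subseteq> UNIV"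
        by (auto simp: eventually_sequentially)
    qed
    have sum: "(\<Sum>n\<in>{- int N..<int N}. f n - f (n + 1)) = f (- int N) - f (int N)" for N
    proof (induction N)
      case (Suc N)
      have "{- int (Suc N)..<int (Suc N)} = {- int (Suc N), int N} \<union> {- int N..<int N}" by auto
      then show ?case using Suc by (cases "N = 0") (auto simp: sum.insert_remove algebra_simps)
    qed simp
    have "(\<lambda>N. f (- int N) - f (int N)) \<longlonglongrightarrow> S"
      using filterlim_compose[OF S[unfolded has_sum_def] lim] by (simp add: sum)
    moreover have "(\<lambda>N. f (- int N) - f (int N)) \<longlonglongrightarrow> 0"
    proof -
      obtain C where C: "C > 0" "\<And>n::int. norm (f n) \<le> C / (1 + \<bar>real_of_int n\<bar>)"
        unfolding f_def using inverse_shift_bound by blast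
      have 0: "(\<lambda>N. C / (1 + real N)) \<longlonglongrightarrow> 0" by real_asymp
      have "(\<lambda>N. f (- int N)) \<longlonglongrightarrow> 0" "(\<lambda>N. f (int N)) \<longlonglongrightarrow> 0"
        by (rule Lim_null_comparison[OF _ 0]; use C(2)[of "- int _"] C(2)[of "int _"] in simp)+
      from tendsto_diff[OF this] show ?thesis by simp
    qed
    ultimately have "S = 0" by (rule LIMSEQ_unique)
    thus ?thesis using S by simp
  qed
  have "((\<lambda>n. f n - f (n + d)) has_sum 0) UNIV"
  proof (induction d rule: int_induct[of _ 0])
    case (step1 i)
    from has_sum_add[OF step1(2) has_sum_shift[OF step, of i]] show ?case by (simp add: add.assoc)
  next
    case (step2 i)
    from has_sum_diff[OF step2(2) has_sum_shift[OF step, of "i - 1"]] show ?case by (simp add: add_diff_eq)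
  qed simp
  thus ?thesis by (simp add: f_def)
qed

section \<open>Products of sums over a row\<close>

text \<open>For integer \<open>y\<close> the pole drops out by \<open>inverse 0 = 0\<close>, so
  \<open>row_sum k 0\<close> is twice the zeta value for even \<open>k \<ge> 2\<close>.\<close>

definition row_sum :: "nat \<Rightarrow> complex \<Rightarrow> complex" where
  "row_sum k y = (\<Sum>\<^sub>\<infinity>n\<in>(UNIV::int set). inverse (y + of_int n) ^ k)"

text \<open>When \<open>u\<close> runs through a full row or lattice and \<open>v = u + d\<close>,
  the powers of \<open>1 / u\<close> and \<open>1 / v\<close> have the same sum; this is their joint
  coefficient in \<open>pf_sum\<close>.\<close>

definition pf_coeff :: "nat \<Rightarrow> nat \<Rightarrow> nat \<Rightarrow> complex" where
  "pf_coeff a b l = (-1) ^ (a + l) * of_nat ((a + b - l - 1) choose (b - 1))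
     + (-1) ^ a * of_nat ((a + b - l - 1) choose (a - 1))"

lemma has_sum_row_sum:
  "k \<ge> 2 \<Longrightarrow> ((\<lambda>n::int. inverse (y + of_int n) ^ k) has_sum row_sum k y) UNIV"
  unfolding row_sum_def by (intro has_sum_infsum summable_inverse_shift_power)

lemma has_sum_row_sum_0:
  "k \<ge> 2 \<Longrightarrow> ((\<lambda>n::int. inverse (of_int n) ^ k) has_sum row_sum k 0) UNIV"
  using has_sum_row_sum[of k 0] by simp

text \<open>Merges the corrections from the poles \<open>u = 0\<close> and \<open>v = 0\<close>, by
  symmetry of the binomials and Pascal's rule.\<close>

lemma pole_coeff_sum:
  assumes "a \<ge> 1" and "b \<ge> 1"
  shows "((a + b - 1) choose a) + ((a + b - 1) choose b) = (a + b) choose a"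
proof -
  obtain a' where a': "a = Suc a'" using assms by (cases a) auto
  have "(a + b - 1) choose b = (a + b - 1) choose (a - 1)"
    using assms binomial_symmetric[of b "a + b - 1"] by simp
  thus ?thesis by (simp add: a')
qed

text \<open>The sum starts at \<open>l = 2\<close> because for \<open>l = 1\<close> the coefficients
  of \<open>s\<close> and \<open>t\<close> are opposite, so that part is a multiple of
  \<open>t - s\<close> and telescopes to 0.\<close>

lemma has_sum_pf_sum_row:
  fixes y :: complex and d :: int
  assumes "a \<ge> 1" and "b \<ge> 1"
  defines "e \<equiv> inverse (of_int d :: complex)"
  shows "((\<lambda>n. pf_sum a b (inverse (y + of_int n)) (inverse (y + of_int (n + d))) e)
    has_sum (\<Sum>l\<in>{2..<a + b}. e ^ (a + b - l) * (pf_coeff a b l * row_sum l y))) UNIV"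
proof -
  let ?s = "\<lambda>n::int. inverse (y + of_int n)"
  let ?t = "\<lambda>n::int. inverse (y + of_int (n + d))"
  let ?A = "\<lambda>l. (-1) ^ (a + l) * of_nat ((a + b - l - 1) choose (b - 1)) :: complex"
  let ?B = "\<lambda>l. (-1) ^ a * of_nat ((a + b - l - 1) choose (a - 1)) :: complex"
  have "((\<lambda>n. e ^ (a + b - l) * (?A l * ?s n ^ l + ?B l * ?t n ^ l))
      has_sum (e ^ (a + b - l) * (pf_coeff a b l * row_sum l y))) UNIV" if "l \<in> {2..<a + b}" for l
  proof -
    have s: "((\<lambda>n. ?s n ^ l) has_sum row_sum l y) UNIV"
      using that by (intro has_sum_row_sum) auto
    have "((\<lambda>n. e ^ (a + b - l) * (?A l * ?s n ^ l + ?B l * ?t n ^ l))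
      has_sum (e ^ (a + b - l) * (?A l * row_sum l y + ?B l * row_sum l y))) UNIV"
      by (intro has_sum_cmult_right has_sum_add s has_sum_shift[OF s, of d])
    thus ?thesis by (simp add: pf_coeff_def distrib_right)
  qed
  from has_sum_sum[OF this]
  have "((\<lambda>n. \<Sum>l\<in>{2..<a + b}. e ^ (a + b - l) * (?A l * ?s n ^ l + ?B l * ?t n ^ l))
    has_sum (\<Sum>l\<in>{2..<a + b}. e ^ (a + b - l) * (pf_coeff a b l * row_sum l y))) UNIV" .
  moreover have "((\<lambda>n. e ^ (a + b - 1) * (?B 1 * (?t n - ?s n))) has_sum 0) UNIV"
  proof -
    have "((\<lambda>n. - (e ^ (a + b - 1) * (?B 1 * (?s n - ?t n)))) has_sum - (e ^ (a + b - 1) * (?B 1 * 0))) UNIV"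
      by (intro has_sum_uminusI has_sum_cmult_right has_sum_telescope)
    thus ?thesis by (simp add: algebra_simps)
  qed
  ultimately have "((\<lambda>n. e ^ (a + b - 1) * (?B 1 * (?t n - ?s n)) +
      (\<Sum>l\<in>{2..<a + b}. e ^ (a + b - l) * (?A l * ?s n ^ l + ?B l * ?t n ^ l)))
    has_sum (0 + (\<Sum>l\<in>{2..<a + b}. e ^ (a + b - l) * (pf_coeff a b l * row_sum l y)))) UNIV"
    by (rule has_sum_add[rotated])
  moreover have "e ^ (a + b - 1) * (?B 1 * (?t n - ?s n)) +
      (\<Sum>l\<in>{2..<a + b}. e ^ (a + b - l) * (?A l * ?s n ^ l + ?B l * ?t n ^ l))
      = pf_sum a b (?s n) (?t n) e" for n
  proof -
    have "{1..<a + b} = insert 1 {2..<a + b}" using assms by auto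
    moreover have "(a + b - 1 - 1) choose (b - 1) = (a + b - 1 - 1) choose (a - 1)"
      using assms binomial_symmetric[of "b - 1" "a + b - 1 - 1"] by simp
    ultimately show ?thesis by (simp add: pf_sum_def algebra_simps)
  qed
  ultimately show ?thesis by simp
qed

text \<open>Pairs in the row are summed first over \<open>n\<close> with fixed difference
  \<open>d\<close>, then over \<open>d\<close>, where the powers of \<open>1 / d\<close> become
  \<open>row_sum\<close> at 0. The diagonal \<open>d = 0\<close> yields
  \<open>row_sum (a + b) y\<close>, and poles are met only for integer \<open>y\<close>.\<close>

theorem row_sum_mult:
  assumes "a \<ge> 2" and "b \<ge> 2"
  shows "row_sum a y * row_sum b y = row_sum (a + b) y
    + (\<Sum>l\<in>{2..<a + b - 1}. pf_coeff a b l * row_sum (a + b - l) 0 * row_sum l y)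
    - (if y \<in> \<int> then (-1) ^ a * of_nat ((a + b) choose a) * row_sum (a + b) 0 else 0)"
proof -
  let ?s = "\<lambda>n::int. inverse (y + of_int n)"
  let ?e = "\<lambda>d::int. inverse (of_int d) :: complex"
  let ?Ca = "(-1) ^ a * of_nat ((a + b - 1) choose a) :: complex"
  let ?Cb = "(-1) ^ a * of_nat ((a + b - 1) choose b) :: complex"
  let ?f = "\<lambda>d. (\<Sum>l\<in>{2..<a + b}. ?e d ^ (a + b - l) * (pf_coeff a b l * row_sum l y))
      + (if d = 0 then row_sum (a + b) y else 0)
      - (if y \<in> \<int> then (?Ca + ?Cb) * ?e d ^ (a + b) else 0)"
  \<comment> \<open>The row contains exactly one pole if \<open>y\<close> is an integer and none
    otherwise.\<close>
  have pole: "((\<lambda>n::int. if y + of_int n = 0 then c else 0) has_sum (if y \<in> \<int> then c else 0)) UNIV"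
    for c :: complex
  proof (cases "y \<in> \<int>")
    case True
    then obtain m where "y = of_int m" by (auto elim: Ints_cases)
    hence "y + of_int n = 0 \<longleftrightarrow> n = - m" for n
      by (simp flip: of_int_add) (simp add: eq_neg_iff_add_eq_0 add.commute)
    thus ?thesis using True has_sum_indicator[of "- m" c] by simp
  next
    case False
    have "y + of_int n \<noteq> 0" for n
    proof
      assume "y + of_int n = 0"
      hence "y = of_int (- n)" by (simp add: eq_neg_iff_add_eq_0)
      thus False using False by simp
    qed
    thus ?thesis using False by simp
  qed
  have inner: "((\<lambda>n. ?s n ^ a * ?s (n + d) ^ b) has_sum ?f d) UNIV" for d
  proof -
    have main: "((\<lambda>n. pf_sum a b (?s n) (?s (n + d)) (?e d)
        + (if d = 0 then ?s n ^ (a + b) else 0)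
        - (if y + of_int n = 0 then ?Ca * ?e d ^ (a + b) else 0)
        - (if y + of_int (n + d) = 0 then ?Cb * ?e d ^ (a + b) else 0))
      has_sum ((\<Sum>l\<in>{2..<a + b}. ?e d ^ (a + b - l) * (pf_coeff a b l * row_sum l y))
        + (if d = 0 then row_sum (a + b) y else 0)
        - (if y \<in> \<int> then ?Ca * ?e d ^ (a + b) else 0)
        - (if y \<in> \<int> then ?Cb * ?e d ^ (a + b) else 0))) UNIV"
      by (intro has_sum_diff has_sum_add has_sum_pf_sum_row pole has_sum_shift[OF pole])
        (use assms has_sum_row_sum[of "a + b" y] in auto)
    have eq: "?s n ^ a * ?s (n + d) ^ b = pf_sum a b (?s n) (?s (n + d)) (?e d)
        + (if d = 0 then ?s n ^ (a + b) else 0)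
        - (if y + of_int n = 0 then ?Ca * ?e d ^ (a + b) else 0)
        - (if y + of_int (n + d) = 0 then ?Cb * ?e d ^ (a + b) else 0)" for n
    proof -
      have "y + of_int (n + d) - (y + of_int n) = of_int d"
        and "y + of_int n = y + of_int (n + d) \<longleftrightarrow> d = 0" by simp_all
      from partial_fraction_inverse[of a b "y + of_int n" "y + of_int (n + d)", unfolded this]
      show ?thesis using assms by fastforce
    qed
    have val: "?f d = (\<Sum>l\<in>{2..<a + b}. ?e d ^ (a + b - l) * (pf_coeff a b l * row_sum l y))
        + (if d = 0 then row_sum (a + b) y else 0)
        - (if y \<in> \<int> then ?Ca * ?e d ^ (a + b) else 0)
        - (if y \<in> \<int> then ?Cb * ?e d ^ (a + b) else 0)"
      by (simp add: distrib_right)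
    show ?thesis unfolding eq val by (rule main)
  qed
  have "((\<lambda>(d, n). ?s n ^ a * ?s (n + d) ^ b) has_sum (row_sum a y * row_sum b y)) (UNIV \<times> UNIV)"
    by (intro has_sum_convolution has_sum_row_sum assms)
  from has_sum_SigmaD[OF this] inner
  have "(?f has_sum (row_sum a y * row_sum b y)) UNIV" by auto
  moreover have "(?f has_sum ((\<Sum>l\<in>{2..<a + b - 1}. row_sum (a + b - l) 0 * (pf_coeff a b l * row_sum l y))
      + row_sum (a + b) y
      - (if y \<in> \<int> then (?Ca + ?Cb) * row_sum (a + b) 0 else 0))) UNIV"
  proof -
    \<comment> \<open>The top index would bring in the first power of \<open>1 / d\<close>, to which
      \<open>has_sum_row_sum_0\<close> does not apply; its coefficient vanishes since
      \<open>a, b \<ge> 2\<close>.\<close>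
    have "pf_coeff a b (a + b - 1) = 0" using assms by (simp add: pf_coeff_def binomial_eq_0)
    moreover have "{2..<a + b} = insert (a + b - 1) {2..<a + b - 1}" using assms by auto
    ultimately have "(\<Sum>l\<in>{2..<a + b}. ?e d ^ (a + b - l) * (pf_coeff a b l * row_sum l y))
      = (\<Sum>l\<in>{2..<a + b - 1}. ?e d ^ (a + b - l) * (pf_coeff a b l * row_sum l y))" for d
      by simp
    moreover have "((\<lambda>d. (\<Sum>l\<in>{2..<a + b - 1}. ?e d ^ (a + b - l) * (pf_coeff a b l * row_sum l y))
      + (if d = 0 then row_sum (a + b) y else 0)
      - (if y \<in> \<int> then (?Ca + ?Cb) * ?e d ^ (a + b) else 0)) has_sum
      ((\<Sum>l\<in>{2..<a + b - 1}. row_sum (a + b - l) 0 * (pf_coeff a b l * row_sum l y))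
      + row_sum (a + b) y
      - (if y \<in> \<int> then (?Ca + ?Cb) * row_sum (a + b) 0 else 0))) UNIV"
      by (intro has_sum_diff has_sum_add has_sum_sum has_sum_cmult_left has_sum_row_sum_0 has_sum_indicator)
        (use assms in \<open>auto intro!: has_sum_cmult_right has_sum_row_sum_0\<close>)
    ultimately show ?thesis by simp
  qed
  ultimately have "row_sum a y * row_sum b y =
      (\<Sum>l\<in>{2..<a + b - 1}. row_sum (a + b - l) 0 * (pf_coeff a b l * row_sum l y))
      + row_sum (a + b) y
      - (if y \<in> \<int> then (?Ca + ?Cb) * row_sum (a + b) 0 else 0)"
    by (rule has_sum_unique)
  moreover have "?Ca + ?Cb = (-1) ^ a * of_nat ((a + b) choose a)"
    using assms by (simp add: pole_coeff_sum[of a b, symmetric] distrib_left)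
  ultimately show ?thesis by (simp add: mult_ac)
qed

section \<open>Row sums at the origin and zeta values\<close>

lemma row_sum_0_odd:
  assumes "odd k"
  shows "row_sum k 0 = 0"
proof -
  have "row_sum k 0 = (\<Sum>\<^sub>\<infinity>n\<in>(UNIV::int set). - (inverse (of_int n) ^ k))"
    unfolding row_sum_def
    by (rule infsum_reindex_bij_witness[of _ uminus uminus]) (use assms in \<open>auto simp: power_minus_odd\<close>)
  also have "\<dots> = - row_sum k 0" by (simp add: infsum_uminus row_sum_def)
  finally show ?thesis by simp
qed

lemma row_sum_0_even:
  assumes "even k" and "k \<ge> 2"
  shows "row_sum k 0 = 2 * zeta_at k"
proof -
  let ?f = "\<lambda>n::int. inverse (of_int n) ^ k :: complex"
  have sum: "?f summable_on A" for A
    by (rule summable_on_subset[of _ UNIV]) (use has_sum_row_sum_0[OF assms(2)] in \<open>auto simp: summable_on_def\<close>)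
  have pos: "infsum ?f (range (\<lambda>n. int (Suc n))) = zeta_at k"
  proof -
    have "infsum ?f (range (\<lambda>n. int (Suc n))) = (\<Sum>\<^sub>\<infinity>n. 1 / of_nat (Suc n) ^ k)"
      by (subst infsum_reindex) (auto simp: inj_on_def o_def power_inverse divide_inverse)
    moreover have "(\<lambda>n::nat. 1 / of_nat (Suc n) ^ k :: complex) summable_on UNIV"
      using sum[of "range (\<lambda>n. int (Suc n))"]
      by (subst (asm) summable_on_reindex) (auto simp: inj_on_def o_def power_inverse divide_inverse)
    ultimately show ?thesis
      using has_sum_imp_sums[OF has_sum_infsum] by (fastforce simp: zeta_at_def sums_iff)
  qed
  have neg: "infsum ?f (range (\<lambda>n. - int (Suc n))) = infsum ?f (range (\<lambda>n. int (Suc n)))"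
    by (rule infsum_reindex_bij_witness[of _ uminus uminus]) (use assms in auto)
  have UN: "UNIV = insert 0 (range (\<lambda>n. int (Suc n)) \<union> range (\<lambda>n. - int (Suc n)))"
  proof (intro set_eqI iffI UNIV_I)
    fix n :: int
    consider "n = 0" | "n = int (Suc (nat (n - 1)))" | "n = - int (Suc (nat (- n - 1)))" by linarith
    thus "n \<in> insert 0 (range (\<lambda>n. int (Suc n)) \<union> range (\<lambda>n. - int (Suc n)))" by cases blast+
  qed
  \<comment> \<open>The index 0 contributes \<open>inverse 0 ^ k = 0\<close>.\<close>
  have "row_sum k 0 = infsum ?f (range (\<lambda>n. int (Suc n)) \<union> range (\<lambda>n. - int (Suc n)))"
    unfolding row_sum_def by (rule infsum_cong_neutral) (use assms UN in auto)
  also have "\<dots> = infsum ?f (range (\<lambda>n. int (Suc n))) + infsum ?f (range (\<lambda>n. - int (Suc n)))"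
    by (intro infsum_Un_disjoint sum) auto
  finally show ?thesis unfolding neg pos by simp
qed

lemma row_sum_0_2: "row_sum 2 0 = of_real pi ^ 2 / 3"
proof -
  have "(\<lambda>n. complex_of_real (1 / real ((n + 1)\<^sup>2))) sums of_real (pi\<^sup>2 / 6)"
    using inverse_squares_sums by (simp only: sums_of_real_iff)
  hence *: "zeta_at 2 = of_real (pi\<^sup>2 / 6)"
    by (simp add: zeta_at_def sums_iff add.commute)
  show ?thesis by (subst row_sum_0_even) (simp_all add: *)
qed

section \<open>Eisenstein series as lattice sums\<close>

definition lat :: "complex \<Rightarrow> int \<times> int \<Rightarrow> complex" where
  "lat \<tau> x = of_int (fst x) + of_int (snd x) * \<tau>"

text \<open>For weight at least 3 the unordered sum over the lattice, on which products and shifts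
  can be carried out; the origin contributes \<open>inverse 0 ^ k = 0\<close>.\<close>

definition lattice_sum :: "nat \<Rightarrow> complex \<Rightarrow> complex" where
  "lattice_sum k \<tau> = (\<Sum>\<^sub>\<infinity>x\<in>UNIV. inverse (lat \<tau> x) ^ k)"

lemma lat_add: "lat \<tau> (x + y) = lat \<tau> x + lat \<tau> y"
  by (simp add: lat_def algebra_simps)

lemma lat_eq_0_iff:
  assumes "Im \<tau> > 0"
  shows "lat \<tau> x = 0 \<longleftrightarrow> x = 0"
  using assms by (cases x) (auto simp: lat_def complex_eq_iff zero_prod_def)

text \<open>The imaginary part of a lattice point controls \<open>n\<close>, and the triangle
  inequality then controls \<open>m\<close>. The summand 1 is affordable because nonzero lattice
  points stay away from 0.\<close>

lemma inverse_lat_bound: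
  assumes "Im \<tau> > 0"
  obtains C where "C > 0"
    "\<And>m n. norm (inverse (lat \<tau> (m, n))) \<le> C / (1 + \<bar>real_of_int m\<bar>)"
    "\<And>m n. norm (inverse (lat \<tau> (m, n))) \<le> C / (1 + \<bar>real_of_int n\<bar>)"
proof -
  define c where "c = 1 / Im \<tau>"
  have c: "c > 0" using assms by (simp add: c_def)
  \<comment> \<open>With \<open>w\<close> the norm of the lattice point, \<open>K\<close> collects
    \<open>1 \<le> (1 + c) w\<close>, \<open>\<bar>n\<bar> \<le> c w\<close> and
    \<open>\<bar>m\<bar> \<le> (1 + norm \<tau> * c) w\<close>.\<close>
  define K where "K = 2 + 2 * c + norm \<tau> * c"
  have K: "K > 0" using c by (auto simp: K_def intro!: add_pos_nonneg)
  have main: "1 + \<bar>real_of_int m\<bar> \<le> K * norm (lat \<tau> (m, n)) \<and> 1 + \<bar>real_of_int n\<bar> \<le> K * norm (lat \<tau> (m, n))"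
    if "lat \<tau> (m, n) \<noteq> 0" for m n
  proof -
    let ?w = "norm (lat \<tau> (m, n))"
    have "\<bar>real_of_int n\<bar> * Im \<tau> \<le> ?w"
      using abs_Im_le_cmod[of "lat \<tau> (m, n)"] assms by (simp add: lat_def abs_mult)
    hence n: "\<bar>real_of_int n\<bar> \<le> c * ?w" using assms by (simp add: c_def field_simps)
    have "norm (of_int m :: complex) \<le> ?w + norm (of_int n * \<tau>)"
      using norm_triangle_ineq4[of "lat \<tau> (m, n)" "of_int n * \<tau>"] by (simp add: lat_def)
    hence m': "\<bar>real_of_int m\<bar> \<le> ?w + \<bar>real_of_int n\<bar> * norm \<tau>" by (simp add: norm_mult)
    have "\<bar>real_of_int n\<bar> * norm \<tau> \<le> (c * ?w) * norm \<tau>"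
      by (rule mult_right_mono[OF n]) simp
    with m' have m: "\<bar>real_of_int m\<bar> \<le> ?w + norm \<tau> * c * ?w" by (simp add: mult_ac)
    have one: "1 \<le> ?w + c * ?w"
    proof (cases "n = 0")
      case True
      with that have "m \<noteq> 0" by (auto simp: lat_def)
      hence "1 \<le> ?w" using True by (simp add: lat_def)
      thus ?thesis using c by (simp add: add_increasing2)
    next
      case False
      hence "1 \<le> \<bar>real_of_int n\<bar>" by linarith
      thus ?thesis using n by (simp add: add_increasing)
    qed
    have "0 \<le> ?w" "0 \<le> c * ?w" "0 \<le> norm \<tau> * c * ?w" using c by simp_all
    moreover have "K * ?w = 2 * ?w + 2 * (c * ?w) + norm \<tau> * c * ?w"
      by (simp add: K_def algebra_simps)
    ultimately show ?thesis using m n one by linarith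
  qed
  have bound: "norm (inverse (lat \<tau> (m, n))) \<le> K / r"
    if "r > 0" "lat \<tau> (m, n) \<noteq> 0 \<Longrightarrow> r \<le> K * norm (lat \<tau> (m, n))" for m n r
  proof (cases "lat \<tau> (m, n) = 0")
    case False
    hence "norm (lat \<tau> (m, n)) > 0" by simp
    hence "1 / norm (lat \<tau> (m, n)) \<le> K / r"
      using that(1) that(2)[OF False] by (simp add: divide_simps mult.commute)
    thus ?thesis by (simp add: norm_divide inverse_eq_divide)
  qed (use that K in simp)
  show ?thesis
  proof (rule that[OF K])
    fix m n
    show "norm (inverse (lat \<tau> (m, n))) \<le> K / (1 + \<bar>real_of_int m\<bar>)"
      by (rule bound[OF _ conjunct1[OF main]]) simp_all
    show "norm (inverse (lat \<tau> (m, n))) \<le> K / (1 + \<bar>real_of_int n\<bar>)"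
      by (rule bound[OF _ conjunct2[OF main]]) simp_all
  qed
qed

lemma inverse_lat_bounded:
  assumes "Im \<tau> > 0"
  obtains C where "\<And>x. norm (inverse (lat \<tau> x)) \<le> C"
proof -
  obtain C where C: "C > 0" "\<And>m n. norm (inverse (lat \<tau> (m, n))) \<le> C / (1 + \<bar>real_of_int m\<bar>)"
    using inverse_lat_bound[OF assms] by metis
  have "norm (inverse (lat \<tau> (m, n))) \<le> C" for m n
    by (rule order_trans[OF C(2)]) (use C(1) in \<open>simp add: field_simps\<close>)
  thus ?thesis by (metis that surj_pair)
qed

text \<open>The geometric mean of the two bounds in \<open>inverse_lat_bound\<close> gives a
  majorant that is a product of functions of \<open>m\<close> and \<open>n\<close>, each with decay
  exponent 3/2 > 1.\<close>

lemma summable_lattice_cube: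
  assumes "Im \<tau> > 0"
  shows "(\<lambda>x. inverse (lat \<tau> x) ^ 3) summable_on UNIV"
proof -
  obtain C where C: "C > 0"
    "\<And>m n. norm (inverse (lat \<tau> (m, n))) \<le> C / (1 + \<bar>real_of_int m\<bar>)"
    "\<And>m n. norm (inverse (lat \<tau> (m, n))) \<le> C / (1 + \<bar>real_of_int n\<bar>)"
    using inverse_lat_bound[OF assms] by metis
  let ?h = "\<lambda>n::int. complex_of_real ((1 + \<bar>real_of_int n\<bar>) powr (- (3 / 2)))"
  have "?h summable_on UNIV"
    by (intro summable_on_of_real summable_on_int_powr) simp
  then obtain S where "(?h has_sum S) UNIV" by (auto simp: summable_on_def)
  from has_sum_imp_summable[OF has_sum_times[OF this this]]
  have "(\<lambda>x. of_real (C ^ 3) * (case x of (m, n) \<Rightarrow> ?h m * ?h n)) summable_on UNIV"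
    by (intro summable_on_cmult_right) simp
  thus ?thesis unfolding summable_on_iff_abs_summable_on_complex
  proof (rule Infinite_Sum.abs_summable_on_comparison_test)
    fix x :: "int \<times> int"
    obtain m n where x: "x = (m, n)" by (cases x)
    define A where "A = 1 + \<bar>real_of_int m\<bar>"
    define B where "B = 1 + \<bar>real_of_int n\<bar>"
    have pos: "A > 0" "B > 0" by (auto simp: A_def B_def)
    let ?r = "norm (inverse (lat \<tau> x))"
    have "?r ^ 2 \<le> (C / A) * (C / B)"
      unfolding power2_eq_square x A_def B_def by (intro mult_mono C) (use C(1) in auto)
    also have "\<dots> = (C * A powr (- (1 / 2)) * B powr (- (1 / 2))) ^ 2"
    proof -
      have "(r powr (- (1 / 2))) ^ 2 = inverse r" if "r > 0" for r :: real
        using that powr_power[of r "- (1 / 2)" 2] by (simp add: powr_minus)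
      with pos show ?thesis by (simp only: power_mult_distrib) (simp add: field_simps power2_eq_square)
    qed
    finally have "?r \<le> C * A powr (- (1 / 2)) * B powr (- (1 / 2))"
      by (rule power2_le_imp_le) (use C(1) in auto)
    hence "?r ^ 3 \<le> (C * A powr (- (1 / 2)) * B powr (- (1 / 2))) ^ 3"
      by (intro power_mono) auto
    also have "\<dots> = C ^ 3 * (A powr (- (3 / 2)) * B powr (- (3 / 2)))"
      using pos by (simp add: power_mult_distrib powr_power)
    finally show "norm (inverse (lat \<tau> x) ^ 3)
        \<le> norm (of_real (C ^ 3) * (case x of (m, n) \<Rightarrow> ?h m * ?h n))"
      using C(1) by (simp add: x norm_mult norm_power A_def B_def)
  qed
qed

lemma has_sum_lattice_sum:
  assumes "Im \<tau> > 0" and "k \<ge> 3"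
  shows "((\<lambda>x. inverse (lat \<tau> x) ^ k) has_sum lattice_sum k \<tau>) UNIV"
proof -
  obtain C where C: "\<And>x. norm (inverse (lat \<tau> x)) \<le> C"
    using inverse_lat_bounded[OF assms(1)] by blast
  have "(\<lambda>x. inverse (lat \<tau> x) ^ k) summable_on UNIV"
    using assms(2)
  proof (induction k rule: dec_induct)
    case (step k)
    from summable_on_mult_bounded[OF step.IH C] show ?case by (simp add: mult.commute)
  qed (rule summable_lattice_cube[OF assms(1)])
  thus ?thesis unfolding lattice_sum_def by (rule has_sum_infsum)
qed

section \<open>Decomposition of Eisenstein series into rows\<close>

lemma inverse_lat_row:
  assumes "Im \<tau> > 0"
  shows "inverse (lat \<tau> (m, n)) = inverse \<tau> * inverse (of_int m / \<tau> + of_int n)"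
proof -
  have "\<tau> \<noteq> 0" using assms by auto
  hence "lat \<tau> (m, n) = \<tau> * (of_int m / \<tau> + of_int n)" by (simp add: lat_def algebra_simps)
  thus ?thesis by simp
qed

lemma infsum_lat_row:
  assumes "Im \<tau> > 0"
  shows "(\<Sum>\<^sub>\<infinity>n. inverse (lat \<tau> (m, n)) ^ k) = inverse \<tau> ^ k * row_sum k (of_int m / \<tau>)"
  unfolding row_sum_def
  by (simp add: inverse_lat_row[OF assms] power_mult_distrib infsum_cmult_right')

text \<open>The omitted pair \<open>(0, 0)\<close> contributes \<open>1 / 0 = 0\<close> anyway.\<close>

lemma eisenstein_G_rows:
  assumes "Im \<tau> > 0" and "k \<ge> 1"
  shows "eisenstein_G k \<tau> = (\<Sum>\<^sub>\<infinity>m. inverse \<tau> ^ k * row_sum k (of_int m / \<tau>))"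
proof -
  have "(\<Sum>\<^sub>\<infinity>n\<in>{n. (m, n) \<noteq> (0, 0)}. 1 / (of_int m + of_int n * \<tau>) ^ k)
      = (\<Sum>\<^sub>\<infinity>n. inverse (lat \<tau> (m, n)) ^ k)" for m
    by (rule infsum_cong_neutral) (use assms(2) in \<open>auto simp: lat_def divide_inverse power_inverse\<close>)
  thus ?thesis unfolding eisenstein_G_def by (simp add: infsum_lat_row[OF assms(1)])
qed

lemma eisenstein_G_eq_lattice_sum:
  assumes "Im \<tau> > 0" and "k \<ge> 3"
  shows "eisenstein_G k \<tau> = lattice_sum k \<tau>"
proof -
  have "(\<lambda>(m, n). inverse (lat \<tau> (m, n)) ^ k) summable_on (UNIV \<times> UNIV)"
    using has_sum_imp_summable[OF has_sum_lattice_sum[OF assms]] by (simp add: case_prod_unfold)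
  from infsum_Sigma'_banach[OF this] show ?thesis
    using assms by (simp add: eisenstein_G_rows lattice_sum_def infsum_lat_row case_prod_unfold)
qed

text \<open>If \<open>m / \<tau> = n\<close> then the lattice point \<open>m - n \<tau>\<close>
  vanishes. Hence the pole term of \<open>row_sum_mult\<close> occurs in row 0 only.\<close>

lemma of_int_div_in_Ints_iff:
  assumes "Im \<tau> > 0"
  shows "of_int m / \<tau> \<in> \<int> \<longleftrightarrow> m = 0"
proof
  assume "of_int m / \<tau> \<in> \<int>"
  then obtain n where "of_int m / \<tau> = of_int n" by (auto elim: Ints_cases)
  moreover have "\<tau> \<noteq> 0" using assms by auto
  ultimately have "of_int m = of_int n * \<tau>" by (simp add: divide_eq_eq)
  hence "lat \<tau> (m, - n) = 0" by (simp add: lat_def)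
  thus "m = 0" using assms by (simp add: lat_eq_0_iff zero_prod_def)
qed simp

text \<open>In weight 2 the rows are summable because \<open>\<Sum>n. 1 / (u (u + \<tau>))\<close> telescopes to 0
  along each row, and subtracting it from \<open>1 / u\<^sup>2\<close> leaves \<open>\<tau> / (u\<^sup>2 (u + \<tau>))\<close>.\<close>

lemma summable_row_sum_2:
  assumes "Im \<tau> > 0"
  shows "(\<lambda>m::int. row_sum 2 (of_int m / \<tau>)) summable_on UNIV"
proof -
  have tau: "\<tau> \<noteq> 0" using assms by auto
  let ?s = "\<lambda>m n. inverse (of_int m / \<tau> + of_int n) :: complex"
  define h where "h x = inverse (lat \<tau> x) ^ 2 * inverse (lat \<tau> (x + (0, 1)))" for x
  have cube: "(\<lambda>x. norm (inverse (lat \<tau> x) ^ 3)) summable_on UNIV"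
    using summable_lattice_cube[OF assms] by (simp only: summable_on_iff_abs_summable_on_complex)
  moreover have "(\<lambda>x. norm (inverse (lat \<tau> (x + (0, 1))) ^ 3)) summable_on UNIV"
    using has_sum_imp_summable[OF has_sum_shift[OF has_sum_infsum[OF summable_lattice_cube[OF assms]]], of "(0, 1)"]
    by (simp only: summable_on_iff_abs_summable_on_complex)
  ultimately have "(\<lambda>x. norm (inverse (lat \<tau> x) ^ 3) + norm (inverse (lat \<tau> (x + (0, 1))) ^ 3)) summable_on UNIV"
    by (rule summable_on_add)
  hence h: "h summable_on UNIV"
    unfolding summable_on_iff_abs_summable_on_complex
  proof (rule Infinite_Sum.abs_summable_on_comparison_test')
    fix x
    \<comment> \<open>This bounds \<open>h\<close> by two copies of the summable cubes, one of them
      shifted.\<close>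
    have "a ^ 2 * b \<le> a ^ 3 + b ^ 3" if "a \<ge> 0" "b \<ge> 0" for a b :: real
    proof (cases "a \<le> b")
      case True
      hence "a ^ 2 * b \<le> b ^ 2 * b" using that by (intro mult_right_mono power_mono)
      thus ?thesis using that by (simp add: power2_eq_square power3_eq_cube add_increasing)
    next
      case False
      hence "a ^ 2 * b \<le> a ^ 2 * a" using that by (intro mult_left_mono) auto
      thus ?thesis using that by (simp add: power2_eq_square power3_eq_cube add_increasing2)
    qed
    thus "norm (h x) \<le> norm (inverse (lat \<tau> x) ^ 3) + norm (inverse (lat \<tau> (x + (0, 1))) ^ 3)"
      unfolding h_def norm_mult norm_power by simp
  qed
  \<comment> \<open>In row 0 the poles at \<open>n = 0\<close> and \<open>n = -1\<close> spoil the
    identity; that single row is put back at the end. The factor \<open>\<tau> ^ 3\<close> undoes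
    the scaling in \<open>inverse_lat_row\<close>.\<close>
  have row: "(\<Sum>\<^sub>\<infinity>n. \<tau> ^ 3 * h (m, n)) = row_sum 2 (of_int m / \<tau>)" if "m \<noteq> 0" for m
  proof -
    have nz: "of_int m / \<tau> + of_int n \<noteq> 0" for n
    proof
      assume "of_int m / \<tau> + of_int n = 0"
      hence "of_int m / \<tau> = of_int (- n)" by (simp add: eq_neg_iff_add_eq_0)
      hence "of_int m / \<tau> \<in> \<int>" by (simp only: Ints_of_int)
      thus False using that of_int_div_in_Ints_iff[OF assms] by simp
    qed
    have "((\<lambda>n. ?s m n ^ 2 - (?s m n - ?s m (n + 1))) has_sum (row_sum 2 (of_int m / \<tau>) - 0)) UNIV"
      by (intro has_sum_diff has_sum_row_sum has_sum_telescope) simp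
    moreover have "?s m n ^ 2 - (?s m n - ?s m (n + 1)) = \<tau> ^ 3 * h (m, n)" for n
    proof -
      have "?s m n - ?s m (n + 1) = ?s m n * ?s m (n + 1)"
        using nz[of n] nz[of "n + 1"] by (simp add: field_simps)
      moreover have "?s m n ^ 2 - ?s m n * ?s m (n + 1) = ?s m n * (?s m n - ?s m (n + 1))"
        by (simp add: power2_eq_square right_diff_distrib)
      ultimately have "?s m n ^ 2 - (?s m n - ?s m (n + 1)) = ?s m n ^ 2 * ?s m (n + 1)"
        by (simp add: power2_eq_square)
      also have "\<dots> = \<tau> ^ 3 * h (m, n)"
      proof -
        have "\<tau> ^ 3 * ((inverse \<tau> * x) ^ 2 * (inverse \<tau> * y)) = x ^ 2 * y" for x y
          using tau by (simp add: field_simps power3_eq_cube power2_eq_square)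
        thus ?thesis
          by (simp only: h_def add_Pair add_0_right inverse_lat_row[OF assms])
      qed
      finally show ?thesis .
    qed
    ultimately show ?thesis by (simp add: infsumI)
  qed
  have "(\<lambda>(m, n). \<tau> ^ 3 * h (m, n)) summable_on (UNIV \<times> UNIV)"
    using summable_on_cmult_right[OF h, of "\<tau> ^ 3"] by (simp add: case_prod_unfold)
  from summable_on_Sigma_banach[OF this]
  have "(\<lambda>m. \<Sum>\<^sub>\<infinity>n. \<tau> ^ 3 * h (m, n)) summable_on (UNIV - {0})"
    by (rule summable_on_subset) auto
  hence "(\<lambda>m. row_sum 2 (of_int m / \<tau>)) summable_on (UNIV - {0})"
    by (rule summable_on_cong[THEN iffD1, rotated]) (use row in auto)
  hence "(\<lambda>m. row_sum 2 (of_int m / \<tau>)) summable_on insert 0 (UNIV - {0})"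
    by (simp only: summable_on_insert_iff)
  thus ?thesis by (simp add: insert_UNIV)
qed

text \<open>Weights from 3 on inherit row summability from the lattice sum; weight 2 rests on
  \<open>summable_row_sum_2\<close>.\<close>

lemma has_sum_rows:
  assumes "Im \<tau> > 0" and "k \<ge> 2"
  shows "((\<lambda>m::int. row_sum k (of_int m / \<tau>)) has_sum (\<tau> ^ k * eisenstein_G k \<tau>)) UNIV"
proof -
  have tau: "\<tau> \<noteq> 0" using assms by auto
  have "(\<lambda>m::int. row_sum k (of_int m / \<tau>)) summable_on UNIV"
  proof (cases "k = 2")
    case False
    hence "k \<ge> 3" using assms(2) by simp
    from has_sum_imp_summable[OF has_sum_lattice_sum[OF assms(1) this]]
    have "(\<lambda>(m, n). inverse (lat \<tau> (m, n)) ^ k) summable_on (UNIV \<times> UNIV)"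
      by (simp add: case_prod_unfold)
    from summable_on_cmult_right[OF summable_on_Sigma_banach[OF this], of "\<tau> ^ k"]
    have "(\<lambda>m. \<tau> ^ k * (inverse \<tau> ^ k * row_sum k (of_int m / \<tau>))) summable_on UNIV"
      by (simp only: infsum_lat_row[OF assms(1)])
    thus ?thesis using tau by (simp flip: mult.assoc power_mult_distrib)
  qed (use summable_row_sum_2[OF assms(1)] in simp)
  from has_sum_infsum[OF this] show ?thesis
    using tau assms
    by (simp add: eisenstein_G_rows infsum_cmult_right' flip: mult.assoc power_mult_distrib)
qed

text \<open>Lattice points \<open>x\<close> and \<open>- x\<close> cancel. Odd weights matter
  because the recursion below runs through them too.\<close>

lemma eisenstein_G_odd:
  assumes "Im \<tau> > 0" and "odd k" and "k \<ge> 3"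
  shows "eisenstein_G k \<tau> = 0"
proof -
  have "lattice_sum k \<tau> = (\<Sum>\<^sub>\<infinity>x\<in>UNIV. - (inverse (lat \<tau> x) ^ k))"
    unfolding lattice_sum_def
  proof (rule infsum_reindex_bij_witness[of _ uminus uminus])
    fix x
    have "lat \<tau> (- x) = - lat \<tau> x" by (simp add: lat_def)
    thus "- (inverse (lat \<tau> (- x)) ^ k) = inverse (lat \<tau> x) ^ k"
      using assms(2) by (simp add: power_minus_odd)
  qed auto
  also have "\<dots> = - lattice_sum k \<tau>" by (simp add: infsum_uminus lattice_sum_def)
  finally show ?thesis using assms by (simp add: eisenstein_G_eq_lattice_sum)
qed

section \<open>Recursions for Eisenstein series\<close>

text \<open>The two hypotheses on \<open>\<alpha>\<close> make the terms with \<open>l = 1\<close> and \<open>l = 2\<close> of the partial fractions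
  cancel, so that only absolutely convergent sums over the lattice remain. The terms with
  \<open>l = 1\<close> need no hypothesis of their own, by Pascal's rule.\<close>

theorem eisenstein_G_recursion:
  fixes \<alpha> :: "nat \<Rightarrow> complex"
  assumes "Im \<tau> > 0" and "finite I"
    and I: "\<And>a. a \<in> I \<Longrightarrow> a \<ge> 3 \<and> a + 3 \<le> N"
    and no_weight_2_left: "(\<Sum>a\<in>I. \<alpha> a * (-1) ^ a * of_nat ((N - 3) choose (a - 2))) = 0"
    and no_weight_2_right: "(\<Sum>a\<in>I. \<alpha> a * (-1) ^ a * of_nat ((N - 3) choose (a - 1))) = 0"
  shows "(\<Sum>a\<in>I. \<alpha> a * (eisenstein_G a \<tau> * eisenstein_G (N - a) \<tau>)) =
    (\<Sum>l\<in>{3..<N - 2}. (\<Sum>a\<in>I. \<alpha> a * pf_coeff a (N - a) l) * (eisenstein_G (N - l) \<tau> * eisenstein_G l \<tau>))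
    + (\<Sum>a\<in>I. \<alpha> a * (1 - (-1) ^ a * of_nat (N choose a))) * eisenstein_G N \<tau>"
proof (cases "I = {}")
  case False
  hence N: "N \<ge> 6" using I by fastforce
  let ?s = "\<lambda>x. inverse (lat \<tau> x)"
  let ?G = "\<lambda>k. lattice_sum k \<tau>"
  \<comment> \<open>\<open>A l\<close> and \<open>B l\<close> are the coefficients of the powers of
    \<open>1 / u\<close> and \<open>1 / v\<close> in the combined partial fractions;
    \<open>c1\<close> and \<open>c2\<close> collect the corrections at \<open>u = 0\<close> and
    \<open>v = 0\<close>.\<close>
  define A where "A l = (\<Sum>a\<in>I. \<alpha> a * ((-1) ^ (a + l) * of_nat ((N - l - 1) choose (N - a - 1))))" for l
  define B where "B l = (\<Sum>a\<in>I. \<alpha> a * ((-1) ^ a * of_nat ((N - l - 1) choose (a - 1))))" for l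
  define c1 where "c1 = (\<Sum>a\<in>I. \<alpha> a * ((-1) ^ a * of_nat ((N - 1) choose a)))"
  define c2 where "c2 = (\<Sum>a\<in>I. \<alpha> a * ((-1) ^ a * of_nat ((N - 1) choose (N - a))))"
  have B2: "B 2 = 0" using no_weight_2_right N by (simp add: B_def mult.assoc)
  have A2: "A 2 = 0"
  proof -
    have "A 2 = (\<Sum>a\<in>I. \<alpha> a * (-1) ^ a * of_nat ((N - 3) choose (a - 2)))"
      unfolding A_def
    proof (rule sum.cong[OF refl])
      fix a assume a: "a \<in> I"
      have "(N - 2 - 1) choose (N - a - 1) = (N - 3) choose (a - 2)"
      proof -
        have "N - a - 1 \<le> N - 3" "N - 3 - (N - a - 1) = a - 2" "N - 2 - 1 = N - 3"
          using I[OF a] N by auto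
        thus ?thesis using binomial_symmetric[of "N - a - 1" "N - 3"] by simp
      qed
      thus "\<alpha> a * ((-1) ^ (a + 2) * of_nat ((N - 2 - 1) choose (N - a - 1)))
          = \<alpha> a * (-1) ^ a * of_nat ((N - 3) choose (a - 2))" by simp
    qed
    thus ?thesis using no_weight_2_left by simp
  qed
  have B1: "B 1 = 0"
  proof -
    have "B 1 = (\<Sum>a\<in>I. \<alpha> a * (-1) ^ a * of_nat ((N - 3) choose (a - 2)))
        + (\<Sum>a\<in>I. \<alpha> a * (-1) ^ a * of_nat ((N - 3) choose (a - 1)))"
      unfolding B_def sum.distrib[symmetric]
    proof (rule sum.cong[OF refl])
      fix a assume a: "a \<in> I"
      have "(N - 1 - 1) choose (a - 1) = ((N - 3) choose (a - 2)) + ((N - 3) choose (a - 1))"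
      proof -
        have "N - 1 - 1 = N - 2" "N - 2 - 1 = N - 3" "a - 1 - 1 = a - 2" "0 < N - 2" "0 < a - 1"
          using I[OF a] N by auto
        thus ?thesis using choose_reduce_nat[of "N - 2" "a - 1"] by simp
      qed
      thus "\<alpha> a * ((-1) ^ a * of_nat ((N - 1 - 1) choose (a - 1)))
          = \<alpha> a * (-1) ^ a * of_nat ((N - 3) choose (a - 2))
          + \<alpha> a * (-1) ^ a * of_nat ((N - 3) choose (a - 1))" by (simp add: algebra_simps)
    qed
    thus ?thesis using no_weight_2_left no_weight_2_right by simp
  qed
  have A1: "A 1 = 0"
  proof -
    have "A 1 = - B 1"
      unfolding A_def B_def sum_negf[symmetric]
    proof (rule sum.cong[OF refl])
      fix a assume a: "a \<in> I"
      have "(N - 1 - 1) choose (N - a - 1) = (N - 1 - 1) choose (a - 1)"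
      proof -
        have "N - a - 1 \<le> N - 2" "N - 2 - (N - a - 1) = a - 1" "N - 1 - 1 = N - 2"
          using I[OF a] N by auto
        thus ?thesis using binomial_symmetric[of "N - a - 1" "N - 2"] by simp
      qed
      thus "\<alpha> a * ((-1) ^ (a + 1) * of_nat ((N - 1 - 1) choose (N - a - 1)))
          = - (\<alpha> a * ((-1) ^ a * of_nat ((N - 1 - 1) choose (a - 1))))" by simp
    qed
    thus ?thesis using B1 by simp
  qed
  \<comment> \<open>At the upper end \<open>1 / d\<close> would occur with exponent at most 2, again
    without absolute convergence; the binomials vanish there because \<open>a\<close> and
    \<open>N - a\<close> are at least 3.\<close>
  have high: "A l = 0 \<and> B l = 0" if "l \<ge> N - 2" for l
    unfolding A_def B_def
  proof (intro conjI sum.neutral ballI)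
    fix a assume a: "a \<in> I"
    have "N - l - 1 < N - a - 1" "N - l - 1 < a - 1" using I[OF a] that N by auto
    thus "\<alpha> a * ((-1) ^ (a + l) * of_nat ((N - l - 1) choose (N - a - 1))) = 0"
      "\<alpha> a * ((-1) ^ a * of_nat ((N - l - 1) choose (a - 1))) = 0"
      by (simp_all add: binomial_eq_0)
  qed
  have poly: "(\<Sum>a\<in>I. \<alpha> a * pf_sum a (N - a) s t e)
      = (\<Sum>l\<in>{3..<N - 2}. e ^ (N - l) * (A l * s ^ l + B l * t ^ l))" for s t e
  proof -
    have "(\<Sum>a\<in>I. \<alpha> a * pf_sum a (N - a) s t e)
      = (\<Sum>a\<in>I. \<Sum>l\<in>{1..<N}. e ^ (N - l) *
          (\<alpha> a * ((-1) ^ (a + l) * of_nat ((N - l - 1) choose (N - a - 1))) * s ^ l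
           + \<alpha> a * ((-1) ^ a * of_nat ((N - l - 1) choose (a - 1))) * t ^ l))"
    proof (rule sum.cong[OF refl])
      fix a assume a: "a \<in> I"
      have "a + (N - a) = N" using I[OF a] by simp
      thus "\<alpha> a * pf_sum a (N - a) s t e = (\<Sum>l\<in>{1..<N}. e ^ (N - l) *
          (\<alpha> a * ((-1) ^ (a + l) * of_nat ((N - l - 1) choose (N - a - 1))) * s ^ l
           + \<alpha> a * ((-1) ^ a * of_nat ((N - l - 1) choose (a - 1))) * t ^ l))"
        unfolding pf_sum_def by (simp add: sum_distrib_left algebra_simps)
    qed
    also have "\<dots> = (\<Sum>l\<in>{1..<N}. e ^ (N - l) * (A l * s ^ l + B l * t ^ l))"
      by (subst sum.swap) (simp add: A_def B_def sum_distrib_left sum_distrib_right distrib_left sum.distrib)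
    also have "\<dots> = (\<Sum>l\<in>{3..<N - 2}. e ^ (N - l) * (A l * s ^ l + B l * t ^ l))"
    proof (rule sum.mono_neutral_right)
      show "\<forall>l\<in>{1..<N} - {3..<N - 2}. e ^ (N - l) * (A l * s ^ l + B l * t ^ l) = 0"
      proof
        fix l assume "l \<in> {1..<N} - {3..<N - 2}"
        then consider "l = 1" | "l = 2" | "l \<ge> N - 2" by fastforce
        thus "e ^ (N - l) * (A l * s ^ l + B l * t ^ l) = 0"
          by cases (use A1 A2 B1 B2 high in auto)
      qed
    qed auto
    finally show ?thesis .
  qed
  \<comment> \<open>Each term is written as a function of \<open>d\<close> times a function of
    \<open>u\<close> or of \<open>u + d\<close>, with indicators as factors, to fit
    \<open>has_sum_times\<close> and \<open>has_sum_times_shift\<close>.\<close>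
  have pointwise: "(\<Sum>a\<in>I. \<alpha> a * (?s u ^ a * ?s (u + d) ^ (N - a))) =
      (\<Sum>l\<in>{3..<N - 2}. A l * (?s d ^ (N - l) * ?s u ^ l) + B l * (?s d ^ (N - l) * ?s (u + d) ^ l))
      + (\<Sum>a\<in>I. \<alpha> a) * ((if d = 0 then 1 else 0) * ?s u ^ N)
      - c1 * (?s d ^ N * (if u = 0 then 1 else 0))
      - c2 * (?s d ^ N * (if u + d = 0 then 1 else 0))" for d u
  proof -
    have "lat \<tau> (u + d) - lat \<tau> u = lat \<tau> d" and "lat \<tau> u = lat \<tau> (u + d) \<longleftrightarrow> d = 0"
      using lat_eq_0_iff[OF assms(1), of d] by (simp_all add: lat_add)
    note pf = partial_fraction_inverse[of _ _ "lat \<tau> u" "lat \<tau> (u + d)", unfolded this lat_eq_0_iff[OF assms(1)]]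
    have "(\<Sum>a\<in>I. \<alpha> a * (?s u ^ a * ?s (u + d) ^ (N - a))) =
      (\<Sum>a\<in>I. \<alpha> a * pf_sum a (N - a) (?s u) (?s (u + d)) (?s d)
        + \<alpha> a * ((if d = 0 then 1 else 0) * ?s u ^ N)
        - \<alpha> a * ((-1) ^ a * of_nat ((N - 1) choose a)) * (?s d ^ N * (if u = 0 then 1 else 0))
        - \<alpha> a * ((-1) ^ a * of_nat ((N - 1) choose (N - a))) * (?s d ^ N * (if u + d = 0 then 1 else 0)))"
    proof (rule sum.cong[OF refl])
      fix a assume a: "a \<in> I"
      have "a \<ge> 1" "N - a \<ge> 1" "a + (N - a) = N" using I[OF a] by auto
      thus "\<alpha> a * (?s u ^ a * ?s (u + d) ^ (N - a)) =
        \<alpha> a * pf_sum a (N - a) (?s u) (?s (u + d)) (?s d)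
        + \<alpha> a * ((if d = 0 then 1 else 0) * ?s u ^ N)
        - \<alpha> a * ((-1) ^ a * of_nat ((N - 1) choose a)) * (?s d ^ N * (if u = 0 then 1 else 0))
        - \<alpha> a * ((-1) ^ a * of_nat ((N - 1) choose (N - a))) * (?s d ^ N * (if u + d = 0 then 1 else 0))"
        by (subst pf) (simp_all add: algebra_simps)
    qed
    also have "\<dots> = (\<Sum>a\<in>I. \<alpha> a * pf_sum a (N - a) (?s u) (?s (u + d)) (?s d))
      + (\<Sum>a\<in>I. \<alpha> a) * ((if d = 0 then 1 else 0) * ?s u ^ N)
      - c1 * (?s d ^ N * (if u = 0 then 1 else 0))
      - c2 * (?s d ^ N * (if u + d = 0 then 1 else 0))"
      by (simp only: sum.distrib sum_subtractf sum_distrib_right c1_def c2_def)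
    finally show ?thesis by (simp add: poly algebra_simps)
  qed
  have "((\<lambda>(d, u). \<Sum>a\<in>I. \<alpha> a * (?s u ^ a * ?s (u + d) ^ (N - a)))
      has_sum (\<Sum>a\<in>I. \<alpha> a * (?G a * ?G (N - a)))) (UNIV \<times> UNIV)"
    unfolding case_prod_unfold
    by (intro has_sum_sum has_sum_cmult_right
        has_sum_convolution[unfolded case_prod_unfold] has_sum_lattice_sum assms) (use I in fastforce)+
  moreover have "((\<lambda>(d, u). \<Sum>a\<in>I. \<alpha> a * (?s u ^ a * ?s (u + d) ^ (N - a)))
      has_sum ((\<Sum>l\<in>{3..<N - 2}. A l * (?G (N - l) * ?G l) + B l * (?G (N - l) * ?G l))
      + (\<Sum>a\<in>I. \<alpha> a) * (1 * ?G N) - c1 * (?G N * 1) - c2 * (?G N * 1))) (UNIV \<times> UNIV)"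
    unfolding pointwise case_prod_unfold
    by (intro has_sum_diff has_sum_add has_sum_sum has_sum_cmult_right
        has_sum_times[unfolded case_prod_unfold] has_sum_times_shift[unfolded case_prod_unfold]
        has_sum_lattice_sum has_sum_indicator assms) (use N in auto)
  ultimately have "(\<Sum>a\<in>I. \<alpha> a * (?G a * ?G (N - a))) =
      (\<Sum>l\<in>{3..<N - 2}. A l * (?G (N - l) * ?G l) + B l * (?G (N - l) * ?G l))
      + (\<Sum>a\<in>I. \<alpha> a) * (1 * ?G N) - c1 * (?G N * 1) - c2 * (?G N * 1)"
    by (rule has_sum_unique)
  also have "\<dots> = (\<Sum>l\<in>{3..<N - 2}. (\<Sum>a\<in>I. \<alpha> a * pf_coeff a (N - a) l) * (?G (N - l) * ?G l))
      + ((\<Sum>a\<in>I. \<alpha> a) - (c1 + c2)) * ?G N"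
  proof -
    have "A l + B l = (\<Sum>a\<in>I. \<alpha> a * pf_coeff a (N - a) l)" for l
      unfolding A_def B_def sum.distrib[symmetric]
    proof (rule sum.cong[OF refl])
      fix a assume a: "a \<in> I"
      have "a + (N - a) = N" using I[OF a] by simp
      thus "\<alpha> a * ((-1) ^ (a + l) * of_nat ((N - l - 1) choose (N - a - 1)))
          + \<alpha> a * ((-1) ^ a * of_nat ((N - l - 1) choose (a - 1))) = \<alpha> a * pf_coeff a (N - a) l"
        by (simp add: pf_coeff_def distrib_left)
    qed
    thus ?thesis by (simp only: distrib_right[symmetric]) (simp add: algebra_simps)
  qed
  also have "(\<Sum>a\<in>I. \<alpha> a) - (c1 + c2) = (\<Sum>a\<in>I. \<alpha> a * (1 - (-1) ^ a * of_nat (N choose a)))"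
    unfolding c1_def c2_def sum.distrib[symmetric] sum_subtractf[symmetric]
  proof (rule sum.cong[OF refl])
    fix a assume a: "a \<in> I"
    have "((N - 1) choose a) + ((N - 1) choose (N - a)) = N choose a"
    proof -
      have "a \<ge> 1" "N - a \<ge> 1" "a + (N - a) = N" using I[OF a] by auto
      thus ?thesis using pole_coeff_sum[of a "N - a"] by simp
    qed
    hence "(of_nat (N choose a) :: complex) = of_nat ((N - 1) choose a) + of_nat ((N - 1) choose (N - a))"
      by (metis of_nat_add)
    thus "\<alpha> a - (\<alpha> a * ((-1) ^ a * of_nat ((N - 1) choose a)) + \<alpha> a * ((-1) ^ a * of_nat ((N - 1) choose (N - a))))
        = \<alpha> a * (1 - (-1) ^ a * of_nat (N choose a))"
      by (simp add: algebra_simps)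
  qed
  finally have main: "(\<Sum>a\<in>I. \<alpha> a * (?G a * ?G (N - a))) =
    (\<Sum>l\<in>{3..<N - 2}. (\<Sum>a\<in>I. \<alpha> a * pf_coeff a (N - a) l) * (?G (N - l) * ?G l))
    + (\<Sum>a\<in>I. \<alpha> a * (1 - (-1) ^ a * of_nat (N choose a))) * ?G N" .
  have G: "eisenstein_G k \<tau> = ?G k" if "k \<ge> 3" for k
    using eisenstein_G_eq_lattice_sum[OF assms(1) that] .
  have "(\<Sum>a\<in>I. \<alpha> a * (eisenstein_G a \<tau> * eisenstein_G (N - a) \<tau>)) = (\<Sum>a\<in>I. \<alpha> a * (?G a * ?G (N - a)))"
    by (intro sum.cong refl) (use I G in fastforce)
  moreover have "(\<Sum>l\<in>{3..<N - 2}. (\<Sum>a\<in>I. \<alpha> a * pf_coeff a (N - a) l) * (eisenstein_G (N - l) \<tau> * eisenstein_G l \<tau>))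
      = (\<Sum>l\<in>{3..<N - 2}. (\<Sum>a\<in>I. \<alpha> a * pf_coeff a (N - a) l) * (?G (N - l) * ?G l))"
  proof (rule sum.cong[OF refl])
    fix l assume "l \<in> {3..<N - 2}"
    hence "l \<ge> 3" "N - l \<ge> 3" by auto
    thus "(\<Sum>a\<in>I. \<alpha> a * pf_coeff a (N - a) l) * (eisenstein_G (N - l) \<tau> * eisenstein_G l \<tau>)
        = (\<Sum>a\<in>I. \<alpha> a * pf_coeff a (N - a) l) * (?G (N - l) * ?G l)" by (simp only: G)
  qed
  ultimately show ?thesis using main N G by simp
qed (use assms in simp)

section \<open>Polynomial expressions with rational coefficients\<close>

lemma rat_polys_on_Rats: "c \<in> \<rat> \<Longrightarrow> (\<lambda>_. c) \<in> rat_polys_on S A"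
  unfolding rat_polys_on_def by (auto elim!: Rats_cases intro!: bexI[of _ "\<lambda>_. c"] rat_polys.const)

lemma rat_polys_on_gen: "f \<in> A \<Longrightarrow> f \<in> rat_polys_on S A"
  unfolding rat_polys_on_def using rat_polys.gen by blast

lemma rat_polys_on_add:
  "f \<in> rat_polys_on S A \<Longrightarrow> g \<in> rat_polys_on S A \<Longrightarrow> (\<lambda>x. f x + g x) \<in> rat_polys_on S A"
  unfolding rat_polys_on_def using rat_polys.add by fastforce

lemma rat_polys_on_mult:
  "f \<in> rat_polys_on S A \<Longrightarrow> g \<in> rat_polys_on S A \<Longrightarrow> (\<lambda>x. f x * g x) \<in> rat_polys_on S A"
  unfolding rat_polys_on_def using rat_polys.mult by fastforce

lemma rat_polys_on_diff:
  "f \<in> rat_polys_on S A \<Longrightarrow> g \<in> rat_polys_on S A \<Longrightarrow> (\<lambda>x. f x - g x) \<in> rat_polys_on S A"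
  using rat_polys_on_add[of f S A "\<lambda>x. - 1 * g x"] rat_polys_on_mult[OF rat_polys_on_Rats, of "- 1" g S A]
  by simp

lemma rat_polys_on_sum:
  "(\<And>i. i \<in> I \<Longrightarrow> f i \<in> rat_polys_on S A) \<Longrightarrow> (\<lambda>x. \<Sum>i\<in>I. f i x) \<in> rat_polys_on S A"
  by (induction I rule: infinite_finite_induct) (auto intro: rat_polys_on_Rats rat_polys_on_add)

lemma rat_polys_on_power: "f \<in> rat_polys_on S A \<Longrightarrow> (\<lambda>x. f x ^ n) \<in> rat_polys_on S A"
  by (induction n) (auto intro: rat_polys_on_Rats rat_polys_on_mult)

lemma rat_polys_on_cong:
  assumes "f \<in> rat_polys_on S A" and "\<And>x. x \<in> S \<Longrightarrow> f x = g x"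
  shows "g \<in> rat_polys_on S A"
  using assms unfolding rat_polys_on_def by auto

lemma Rats_sum: "(\<And>i. i \<in> I \<Longrightarrow> f i \<in> \<rat>) \<Longrightarrow> (\<Sum>i\<in>I. f i) \<in> (\<rat> :: complex set)"
  by (induction I rule: infinite_finite_induct) auto

lemma pf_coeff_Rats: "pf_coeff a b l \<in> \<rat>"
  by (simp add: pf_coeff_def)

text \<open>For even \<open>k \<ge> 4\<close>, \<open>row_sum_mult\<close> at \<open>y = 0\<close>
  with weights 2 and \<open>k - 2\<close> can be solved for \<open>row_sum k 0\<close> in terms of
  lower weights. The start is Euler's value of zeta at 2.\<close>

lemma row_sum_0_rat_poly:
  assumes "(\<lambda>_. of_real pi ^ 2) \<in> A" and "k \<ge> 2"
  shows "(\<lambda>_. row_sum k 0) \<in> rat_polys_on S A"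
  using assms(2)
proof (induction k rule: less_induct)
  case (less k)
  consider "k = 2" | "odd k" | "even k" "k \<ge> 4" using less.prems by fastforce
  then show ?case
  proof cases
    case 1
    have "(\<lambda>_. 1 / 3 * of_real pi ^ 2) \<in> rat_polys_on S A"
      by (intro rat_polys_on_mult rat_polys_on_gen assms(1) rat_polys_on_Rats) auto
    thus ?thesis using 1 by (simp add: row_sum_0_2)
  next
    case 2
    thus ?thesis by (simp add: row_sum_0_odd rat_polys_on_Rats)
  next
    case 3
    \<comment> \<open>The factor of \<open>row_sum k 0\<close> after collecting the term of weight
      \<open>k\<close> and the pole correction.\<close>
    define c where "c = (of_nat (k choose 2) - 1 :: complex)"
    have c: "c \<noteq> 0" "c \<in> \<rat>"
    proof -
      have "k choose 2 \<ge> 4 choose 2" using 3 by (intro binomial_right_mono)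
      hence "k choose 2 \<noteq> 1" by (simp add: eval_nat_numeral)
      thus "c \<noteq> 0" unfolding c_def by (metis of_nat_1 of_nat_eq_iff right_minus_eq)
    qed (simp add: c_def)
    have "row_sum 2 0 * row_sum (k - 2) 0 = row_sum k 0
        + (\<Sum>l\<in>{2..<k - 1}. pf_coeff 2 (k - 2) l * row_sum (k - l) 0 * row_sum l 0)
        - of_nat (k choose 2) * row_sum k 0"
    proof -
      have "2 + (k - 2) = k" "k - 2 \<ge> 2" using 3 by auto
      thus ?thesis using row_sum_mult[of 2 "k - 2" 0] by simp
    qed
    hence "c * row_sum k 0 = (\<Sum>l\<in>{2..<k - 1}. pf_coeff 2 (k - 2) l * row_sum (k - l) 0 * row_sum l 0)
        - row_sum 2 0 * row_sum (k - 2) 0"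
      by (simp add: c_def algebra_simps)
    hence "row_sum k 0 = 1 / c * ((\<Sum>l\<in>{2..<k - 1}. pf_coeff 2 (k - 2) l * row_sum (k - l) 0 * row_sum l 0)
        - row_sum 2 0 * row_sum (k - 2) 0)"
      using c by (simp add: field_simps)
    moreover have "(\<lambda>_. 1 / c * ((\<Sum>l\<in>{2..<k - 1}. pf_coeff 2 (k - 2) l * row_sum (k - l) 0 * row_sum l 0)
        - row_sum 2 0 * row_sum (k - 2) 0)) \<in> rat_polys_on S A"
      by (intro rat_polys_on_mult rat_polys_on_diff rat_polys_on_sum rat_polys_on_Rats pf_coeff_Rats
          less.IH) (use 3 c in auto)
    ultimately show ?thesis by simp
  qed
qed

section \<open>Eisenstein series as polynomials in \<open>G_4\<close> and \<open>G_6\<close>\<close>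

lemma choose_explicit:
  "(of_nat (n choose 2) :: complex) = of_nat n * (of_nat n - 1) / 2"
  "(of_nat (n choose 3) :: complex) = of_nat n * (of_nat n - 1) * (of_nat n - 2) / 6"
  "(of_nat (n choose 4) :: complex) = of_nat n * (of_nat n - 1) * (of_nat n - 2) * (of_nat n - 3) / 24"
  "(of_nat (n choose 5) :: complex) =
     of_nat n * (of_nat n - 1) * (of_nat n - 2) * (of_nat n - 3) * (of_nat n - 4) / 120"
  by (simp_all add: binomial_gbinomial gbinomial_prod_rev eval_nat_numeral fact_Suc algebra_simps)

text \<open>Up to a common factor these are the only weights on the products \<open>G\<^sub>a G\<^sub>N\<^sub>-\<^sub>a\<close>, \<open>a = 3, 4, 5\<close>,
  for which no terms of weight 1 and 2 arise in the partial fractions.\<close>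

lemma recursion_weights:
  fixes k N :: nat and \<alpha> :: "nat \<Rightarrow> complex"
  assumes N: "N = k + 8"
    and \<alpha>: "\<alpha> 3 = of_nat ((k + 4) * (k + 3))" "\<alpha> 4 = of_nat (6 * (k + 3))" "\<alpha> 5 = 12"
  shows "(\<Sum>a\<in>{3, 4, 5}. \<alpha> a * (-1) ^ a * of_nat ((N - 3) choose (a - 2))) = 0"
    "(\<Sum>a\<in>{3, 4, 5}. \<alpha> a * (-1) ^ a * of_nat ((N - 3) choose (a - 1))) = 0"
    "60 * (\<Sum>a\<in>{3, 4, 5}. \<alpha> a * (1 - (-1) ^ a * of_nat (N choose a)))
      = of_nat (60 * ((k + 4) * (k + 3) + 6 * (k + 3) + 12) + (k + 8) * (k + 7) * (k + 6) * (k * k + 4 * k + 15))"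
proof -
  have "N - 3 = k + 5" using N by simp
  thus "(\<Sum>a\<in>{3, 4, 5}. \<alpha> a * (-1) ^ a * of_nat ((N - 3) choose (a - 2))) = 0"
    "(\<Sum>a\<in>{3, 4, 5}. \<alpha> a * (-1) ^ a * of_nat ((N - 3) choose (a - 1))) = 0"
    by (simp_all add: \<alpha> choose_explicit) (simp_all add: field_simps)
  \<comment> \<open>The factor 60 clears the denominators left by the binomials; as a natural number
    with positive terms the result is visibly nonzero.\<close>
  show "60 * (\<Sum>a\<in>{3, 4, 5}. \<alpha> a * (1 - (-1) ^ a * of_nat (N choose a)))
      = of_nat (60 * ((k + 4) * (k + 3) + 6 * (k + 3) + 12) + (k + 8) * (k + 7) * (k + 6) * (k * k + 4 * k + 15))"
    by (simp add: \<alpha> choose_explicit N) (simp add: field_simps)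
qed

text \<open>For even \<open>k \<ge> 8\<close> the recursion with the weights above is solved for
  \<open>eisenstein_G k\<close>; all other series in it have weights between 3 and
  \<open>k - 3\<close>.\<close>

lemma eisenstein_G_rat_poly:
  assumes "eisenstein_G 4 \<in> A" and "eisenstein_G 6 \<in> A" and "k \<ge> 3"
  shows "eisenstein_G k \<in> rat_polys_on upper_half_plane A"
  using assms(3)
proof (induction k rule: less_induct)
  case (less k)
  have "k = 4 \<or> k = 6 \<or> odd k \<or> even k \<and> k \<ge> 8" using less.prems by presburger
  then consider "k = 4 \<or> k = 6" | "odd k" | "even k" "k \<ge> 8" by blast
  then show ?case
  proof cases
    case 1
    thus ?thesis using assms by (auto intro: rat_polys_on_gen)
  next
    case 2
    show ?thesis
      by (rule rat_polys_on_cong[OF rat_polys_on_Rats[of 0]])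
        (use 2 less.prems in \<open>auto simp: upper_half_plane_def eisenstein_G_odd\<close>)
  next
    case 3
    then obtain n where n: "k = n + 8" by (metis le_add_diff_inverse2)
    define \<alpha> :: "nat \<Rightarrow> complex" where
      "\<alpha> a = (if a = 3 then of_nat ((n + 4) * (n + 3)) else if a = 4 then of_nat (6 * (n + 3)) else 12)" for a
    have \<alpha>: "\<alpha> 3 = of_nat ((n + 4) * (n + 3))" "\<alpha> 4 = of_nat (6 * (n + 3))" "\<alpha> 5 = 12"
      by (simp_all add: \<alpha>_def)
    have \<alpha>_Rats: "\<alpha> a \<in> \<rat>" for a by (simp add: \<alpha>_def)
    note \<alpha>_eqs = recursion_weights[OF n \<alpha>]
    define c where "c = (\<Sum>a\<in>{3, 4, 5}. \<alpha> a * (1 - (-1) ^ a * of_nat (k choose a)))"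
    have c: "c \<noteq> 0"
    proof
      assume "c = 0"
      let ?P = "60 * ((n + 4) * (n + 3) + 6 * (n + 3) + 12) + (n + 8) * (n + 7) * (n + 6) * (n * n + 4 * n + 15)"
      have "(of_nat ?P :: complex) = 60 * c" unfolding c_def by (rule \<alpha>_eqs(3)[symmetric])
      with \<open>c = 0\<close> have "?P = 0" by (simp only: mult_zero_right of_nat_eq_0_iff)
      thus False by simp
    qed
    have c_Rats: "c \<in> \<rat>" unfolding c_def by (intro Rats_sum Rats_mult Rats_diff \<alpha>_Rats) auto
    let ?r = "\<lambda>l. \<Sum>a\<in>{3, 4, 5}. \<alpha> a * pf_coeff a (k - a) l"
    let ?f = "\<lambda>\<tau>. 1 / c * ((\<Sum>a\<in>{3, 4, 5}. \<alpha> a * (eisenstein_G a \<tau> * eisenstein_G (k - a) \<tau>))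
        - (\<Sum>l\<in>{3..<k - 2}. ?r l * (eisenstein_G (k - l) \<tau> * eisenstein_G l \<tau>)))"
    have "?f \<in> rat_polys_on upper_half_plane A"
      by (intro rat_polys_on_mult rat_polys_on_diff rat_polys_on_sum rat_polys_on_Rats
          Rats_divide Rats_1 Rats_sum Rats_mult pf_coeff_Rats \<alpha>_Rats c_Rats less.IH) (use 3 in auto)
    thus ?thesis
    proof (rule rat_polys_on_cong)
      fix \<tau> assume "\<tau> \<in> upper_half_plane"
      hence tau: "Im \<tau> > 0" by (simp add: upper_half_plane_def)
      have "(\<Sum>a\<in>{3, 4, 5}. \<alpha> a * (eisenstein_G a \<tau> * eisenstein_G (k - a) \<tau>)) =
        (\<Sum>l\<in>{3..<k - 2}. ?r l * (eisenstein_G (k - l) \<tau> * eisenstein_G l \<tau>)) + c * eisenstein_G k \<tau>"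
        unfolding c_def
        by (rule eisenstein_G_recursion[OF tau _ _ \<alpha>_eqs(1,2)]) (use 3 in auto)
      thus "?f \<tau> = eisenstein_G k \<tau>" using c by simp
    qed
  qed
qed

section \<open>The double series\<close>

text \<open>In row \<open>m\<close> the two inner sums factor into a product of row sums at
  \<open>m / \<tau>\<close>. \<open>row_sum_mult\<close> makes this product linear in row sums, and
  summing over \<open>m\<close> turns these into Eisenstein series; the pole term enters once, from
  \<open>m = 0\<close>.\<close>

theorem double_G_rows:
  assumes "Im \<tau> > 0" and "a \<ge> 2" and "b \<ge> 2"
  shows "double_G a b \<tau> = eisenstein_G (a + b) \<tau>
    + (\<Sum>l\<in>{2..<a + b - 1}. pf_coeff a b l * row_sum (a + b - l) 0 / \<tau> ^ (a + b - l) * eisenstein_G l \<tau>)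
    - (-1) ^ a * of_nat ((a + b) choose a) * row_sum (a + b) 0 / \<tau> ^ (a + b)"
proof -
  have tau: "\<tau> \<noteq> 0" using assms by auto
  define c where "c = (-1) ^ a * of_nat ((a + b) choose a) * row_sum (a + b) 0"
  let ?y = "\<lambda>m::int. of_int m / \<tau>"
  have row: "(\<Sum>\<^sub>\<infinity>n\<^sub>1\<in>{n. (m, n) \<noteq> (0, 0)}. \<Sum>\<^sub>\<infinity>n\<^sub>2\<in>{n. (m, n) \<noteq> (0, 0)}.
          1 / ((of_int m + of_int n\<^sub>1 * \<tau>) ^ a * (of_int m + of_int n\<^sub>2 * \<tau>) ^ b))
      = inverse \<tau> ^ (a + b) * (row_sum a (?y m) * row_sum b (?y m))" for m
  proof -
    let ?A = "{n::int. (m, n) \<noteq> (0, 0)}"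
    have restrict: "(\<Sum>\<^sub>\<infinity>n\<in>?A. inverse (lat \<tau> (m, n)) ^ k) = inverse \<tau> ^ k * row_sum k (?y m)"
      if "k \<ge> 2" for k
      unfolding infsum_lat_row[OF assms(1), symmetric]
      by (rule infsum_cong_neutral) (use that in \<open>auto simp: lat_def\<close>)
    have "(\<Sum>\<^sub>\<infinity>n\<^sub>1\<in>?A. \<Sum>\<^sub>\<infinity>n\<^sub>2\<in>?A. 1 / ((of_int m + of_int n\<^sub>1 * \<tau>) ^ a * (of_int m + of_int n\<^sub>2 * \<tau>) ^ b))
        = (\<Sum>\<^sub>\<infinity>n\<^sub>1\<in>?A. \<Sum>\<^sub>\<infinity>n\<^sub>2\<in>?A. inverse (lat \<tau> (m, n\<^sub>1)) ^ a * inverse (lat \<tau> (m, n\<^sub>2)) ^ b)"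
      by (simp add: lat_def divide_inverse power_inverse)
    also have "\<dots> = (\<Sum>\<^sub>\<infinity>n\<in>?A. inverse (lat \<tau> (m, n)) ^ a) * (\<Sum>\<^sub>\<infinity>n\<in>?A. inverse (lat \<tau> (m, n)) ^ b)"
      by (simp only: infsum_cmult_right' infsum_cmult_left')
    finally show ?thesis by (simp only: restrict assms) (simp add: power_add)
  qed
  have "((\<lambda>m. row_sum (a + b) (?y m)
      + (\<Sum>l\<in>{2..<a + b - 1}. pf_coeff a b l * row_sum (a + b - l) 0 * row_sum l (?y m))
      - (if m = 0 then c else 0)) has_sum
      (\<tau> ^ (a + b) * eisenstein_G (a + b) \<tau>
      + (\<Sum>l\<in>{2..<a + b - 1}. pf_coeff a b l * row_sum (a + b - l) 0 * (\<tau> ^ l * eisenstein_G l \<tau>))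
      - c)) UNIV"
    by (intro has_sum_diff has_sum_add has_sum_sum has_sum_cmult_right has_sum_rows has_sum_indicator)
      (use assms in auto)
  hence "((\<lambda>m. row_sum a (?y m) * row_sum b (?y m)) has_sum
      (\<tau> ^ (a + b) * eisenstein_G (a + b) \<tau>
      + (\<Sum>l\<in>{2..<a + b - 1}. pf_coeff a b l * row_sum (a + b - l) 0 * (\<tau> ^ l * eisenstein_G l \<tau>))
      - c)) UNIV"
    by (simp only: row_sum_mult[OF assms(2,3)] of_int_div_in_Ints_iff[OF assms(1)] c_def)
  hence "double_G a b \<tau> = inverse \<tau> ^ (a + b) * (\<tau> ^ (a + b) * eisenstein_G (a + b) \<tau>
      + (\<Sum>l\<in>{2..<a + b - 1}. pf_coeff a b l * row_sum (a + b - l) 0 * (\<tau> ^ l * eisenstein_G l \<tau>))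
      - c)"
    unfolding double_G_def row by (simp add: infsum_cmult_right' infsumI)
  also have "\<dots> = eisenstein_G (a + b) \<tau>
    + (\<Sum>l\<in>{2..<a + b - 1}. inverse \<tau> ^ (a + b) * (pf_coeff a b l * row_sum (a + b - l) 0 * (\<tau> ^ l * eisenstein_G l \<tau>)))
    - c / \<tau> ^ (a + b)"
    using tau by (simp add: distrib_left right_diff_distrib sum_distrib_left divide_inverse power_inverse)
  also have "(\<Sum>l\<in>{2..<a + b - 1}. inverse \<tau> ^ (a + b) * (pf_coeff a b l * row_sum (a + b - l) 0 * (\<tau> ^ l * eisenstein_G l \<tau>)))
    = (\<Sum>l\<in>{2..<a + b - 1}. pf_coeff a b l * row_sum (a + b - l) 0 / \<tau> ^ (a + b - l) * eisenstein_G l \<tau>)"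
  proof (rule sum.cong[OF refl])
    fix l assume "l \<in> {2..<a + b - 1}"
    hence "l < a + b - 1" by simp
    hence "a + b = (a + b - l) + l" by linarith
    hence "\<tau> ^ (a + b) = \<tau> ^ (a + b - l) * \<tau> ^ l" by (metis power_add)
    thus "inverse \<tau> ^ (a + b) * (pf_coeff a b l * row_sum (a + b - l) 0 * (\<tau> ^ l * eisenstein_G l \<tau>))
        = pf_coeff a b l * row_sum (a + b - l) 0 / \<tau> ^ (a + b - l) * eisenstein_G l \<tau>"
      using tau by (simp add: power_inverse field_simps)
  qed
  finally show ?thesis by (simp add: c_def)
qed

section \<open>Reduction to even weights\<close>

lemma sum_even_indices:
  fixes f :: "nat \<Rightarrow> complex"
  assumes "\<And>l. odd l \<Longrightarrow> f l = 0"
  shows "(\<Sum>l\<in>{2..<2 * n - 1}. f l) = (\<Sum>l\<in>{1..<n}. f (2 * l))"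
proof -
  have "(\<Sum>l\<in>{2..<2 * n - 1}. f l) = (\<Sum>l\<in>(\<lambda>l. 2 * l) ` {1..<n}. f l)"
  proof (rule sum.mono_neutral_right)
    show "\<forall>l\<in>{2..<2 * n - 1} - (\<lambda>l. 2 * l) ` {1..<n}. f l = 0"
    proof
      fix l assume l: "l \<in> {2..<2 * n - 1} - (\<lambda>l. 2 * l) ` {1..<n}"
      have "odd l"
      proof
        assume "even l"
        then obtain j where j: "l = 2 * j" by blast
        hence "j \<in> {1..<n}" using l by auto
        thus False using l j by blast
      qed
      thus "f l = 0" by (rule assms)
    qed
  qed auto
  also have "\<dots> = (\<Sum>l\<in>{1..<n}. f (2 * l))"
    by (subst sum.reindex) (auto simp: inj_on_def)
  finally show ?thesis .
qed

lemma sum_compositions: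
  fixes f :: "nat \<Rightarrow> nat \<Rightarrow> complex"
  shows "(\<Sum>(l, h)\<in>{(l, h). l \<ge> 1 \<and> h \<ge> 1 \<and> l + h = n}. f l h) = (\<Sum>l\<in>{1..<n}. f l (n - l))"
  by (rule sum.reindex_bij_witness[of _ "\<lambda>l. (l, n - l)" fst]) auto

lemma pf_coeff_even:
  "pf_coeff (2 * p) (2 * q) (2 * l) =
    of_nat ((2 * (p + q - l) - 1) choose (2 * q - 1)) + of_nat ((2 * (p + q - l) - 1) choose (2 * p - 1))"
proof -
  have "2 * p + 2 * q - 2 * l - 1 = 2 * (p + q - l) - 1" by simp
  thus ?thesis by (simp add: pf_coeff_def)
qed

text \<open>Stated for general \<open>z\<close> and \<open>g\<close> because it serves twice: for
  the double series, with zeta values over powers of \<open>\<tau>\<close> and Eisenstein series,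
  and for the product of two zeta values.\<close>

lemma sum_pf_coeff_even:
  fixes z g :: "nat \<Rightarrow> complex"
  assumes "\<And>h. odd h \<Longrightarrow> z h = 0"
  shows "(\<Sum>l\<in>{2..<2 * p + 2 * q - 1}. pf_coeff (2 * p) (2 * q) l * z (2 * p + 2 * q - l) * g l)
    = (\<Sum>(l\<^sub>1, l\<^sub>2)\<in>{(l\<^sub>1, l\<^sub>2). l\<^sub>1 \<ge> 1 \<and> l\<^sub>2 \<ge> 1 \<and> l\<^sub>1 + l\<^sub>2 = p + q}.
         of_nat ((2 * l\<^sub>2 - 1) choose (2 * q - 1)) * z (2 * l\<^sub>2) * g (2 * l\<^sub>1)
       + of_nat ((2 * l\<^sub>1 - 1) choose (2 * p - 1)) * z (2 * l\<^sub>1) * g (2 * l\<^sub>2))"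
proof -
  let ?n = "p + q"
  let ?F = "\<lambda>r l h. of_nat ((2 * h - 1) choose (2 * r - 1)) * z (2 * h) * g (2 * l)"
  \<comment> \<open>Cutting \<open>g\<close> off at odd \<open>l\<close> makes the summand vanish at
    every odd index, as \<open>sum_even_indices\<close> demands; beyond \<open>2 * ?n\<close>
    truncated subtraction would give \<open>z 0\<close>, about which nothing is known.\<close>
  have "(\<Sum>l\<in>{2..<2 * p + 2 * q - 1}. pf_coeff (2 * p) (2 * q) l * z (2 * p + 2 * q - l) * g l)
    = (\<Sum>l\<in>{2..<2 * ?n - 1}. pf_coeff (2 * p) (2 * q) l * z (2 * ?n - l) * (if even l then g l else 0))"
  proof (rule sum.cong)
    fix l assume l: "l \<in> {2..<2 * ?n - 1}"
    hence "l < 2 * ?n - 1" by simp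
    hence "l \<le> 2 * ?n" by linarith
    hence "z (2 * ?n - l) = 0" if "odd l" using that by (intro assms) (simp add: even_diff_nat)
    thus "pf_coeff (2 * p) (2 * q) l * z (2 * p + 2 * q - l) * g l
      = pf_coeff (2 * p) (2 * q) l * z (2 * ?n - l) * (if even l then g l else 0)" by simp
  qed (simp add: distrib_left)
  also have "\<dots> = (\<Sum>l\<in>{1..<?n}. pf_coeff (2 * p) (2 * q) (2 * l) * z (2 * ?n - 2 * l) * g (2 * l))"
    by (subst sum_even_indices) auto
  also have "\<dots> = (\<Sum>l\<in>{1..<?n}. ?F q l (?n - l) + ?F p l (?n - l))"
  proof (rule sum.cong[OF refl])
    fix l assume "l \<in> {1..<?n}"
    moreover have "2 * ?n - 2 * l = 2 * (?n - l)" by simp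
    ultimately show "pf_coeff (2 * p) (2 * q) (2 * l) * z (2 * ?n - 2 * l) * g (2 * l)
        = ?F q l (?n - l) + ?F p l (?n - l)"
      by (simp only: pf_coeff_even atLeastLessThan_iff distrib_right)
  qed
  also have "\<dots> = (\<Sum>l\<in>{1..<?n}. ?F q l (?n - l)) + (\<Sum>l\<in>{1..<?n}. ?F p l (?n - l))"
    by (rule sum.distrib)
  \<comment> \<open>Reversing this half of the sum lets the binomial with \<open>p\<close> carry the
    index \<open>l\<^sub>1\<close>, as in the symmetric form of the formula.\<close>
  also have "(\<Sum>l\<in>{1..<?n}. ?F p l (?n - l)) = (\<Sum>l\<in>{1..<?n}. ?F p (?n - l) l)"
    by (rule sum.reindex_bij_witness[of _ "\<lambda>l. ?n - l" "\<lambda>l. ?n - l"]) auto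
  also have "(\<Sum>l\<in>{1..<?n}. ?F q l (?n - l)) + \<dots>
      = (\<Sum>l\<in>{1..<?n}. ?F q l (?n - l) + ?F p (?n - l) l)"
    by (rule sum.distrib[symmetric])
  finally show ?thesis by (simp only: sum_compositions)
qed

text \<open>\<open>double_G_rows\<close> leaves a constant term with
  \<open>(2 * p + 2 * q) choose (2 * p)\<close>. The bracket of zeta values is that same constant,
  by \<open>row_sum_mult\<close> at \<open>y = 0\<close>, where the same coefficients occur.\<close>

theorem double_G_formula:
  fixes p q :: nat
  assumes "p \<ge> 1" and "q \<ge> 1" and "Im \<tau> > 0"
  shows "double_G (2 * p) (2 * q) \<tau> =
        eisenstein_G (2 * (p + q)) \<tau>
        + (\<Sum>(l\<^sub>1, l\<^sub>2)\<in>{(l\<^sub>1, l\<^sub>2). l\<^sub>1 \<ge> 1 \<and> l\<^sub>2 \<ge> 1 \<and> l\<^sub>1 + l\<^sub>2 = p + q}.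
            2 * zeta_at (2 * l\<^sub>2) * of_nat ((2 * l\<^sub>2 - 1) choose (2 * q - 1)) / \<tau> ^ (2 * l\<^sub>2)
              * eisenstein_G (2 * l\<^sub>1) \<tau>
            + 2 * zeta_at (2 * l\<^sub>1) * of_nat ((2 * l\<^sub>1 - 1) choose (2 * p - 1)) / \<tau> ^ (2 * l\<^sub>1)
              * eisenstein_G (2 * l\<^sub>2) \<tau>)
        + 4 / \<tau> ^ (2 * (p + q)) *
          (zeta_at (2 * p) * zeta_at (2 * q) - 1 / 2 * zeta_at (2 * (p + q))
           - (\<Sum>(l\<^sub>1, l\<^sub>2)\<in>{(l\<^sub>1, l\<^sub>2). l\<^sub>1 \<ge> 1 \<and> l\<^sub>2 \<ge> 1 \<and> l\<^sub>1 + l\<^sub>2 = p + q}.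
               zeta_at (2 * l\<^sub>1) * zeta_at (2 * l\<^sub>2)
               * (of_nat ((2 * l\<^sub>2 - 1) choose (2 * q - 1))
                  + of_nat ((2 * l\<^sub>1 - 1) choose (2 * p - 1)))))"
    (is "_ = ?G + ?S + 4 / ?t * (?zz - 1 / 2 * ?z - ?T)")
proof -
  let ?C = "of_nat ((2 * p + 2 * q) choose (2 * p)) * row_sum (2 * p + 2 * q) 0"
  have pq: "2 * p + 2 * q = 2 * (p + q)" by simp
  have zeta: "row_sum (2 * l) 0 = 2 * zeta_at (2 * l)" if "l \<ge> 1" for l
    using that by (intro row_sum_0_even) auto
  have "double_G (2 * p) (2 * q) \<tau> = eisenstein_G (2 * p + 2 * q) \<tau>
    + (\<Sum>l\<in>{2..<2 * p + 2 * q - 1}. pf_coeff (2 * p) (2 * q) l *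
        (row_sum (2 * p + 2 * q - l) 0 / \<tau> ^ (2 * p + 2 * q - l)) * eisenstein_G l \<tau>)
    - ?C / \<tau> ^ (2 * p + 2 * q)"
    using double_G_rows[OF assms(3), of "2 * p" "2 * q"] assms by simp
  also have "(\<Sum>l\<in>{2..<2 * p + 2 * q - 1}. pf_coeff (2 * p) (2 * q) l *
        (row_sum (2 * p + 2 * q - l) 0 / \<tau> ^ (2 * p + 2 * q - l)) * eisenstein_G l \<tau>) = ?S"
    by (subst sum_pf_coeff_even) (auto simp: row_sum_0_odd zeta intro!: sum.cong, simp add: mult_ac)
  finally have double: "double_G (2 * p) (2 * q) \<tau> = ?G + ?S - ?C / ?t" by (simp only: pq)
  have "row_sum (2 * p) 0 * row_sum (2 * q) 0 = row_sum (2 * p + 2 * q) 0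
      + (\<Sum>l\<in>{2..<2 * p + 2 * q - 1}. pf_coeff (2 * p) (2 * q) l * row_sum (2 * p + 2 * q - l) 0 * row_sum l 0)
      - ?C"
    using row_sum_mult[of "2 * p" "2 * q" 0] assms by simp
  also have "(\<Sum>l\<in>{2..<2 * p + 2 * q - 1}. pf_coeff (2 * p) (2 * q) l * row_sum (2 * p + 2 * q - l) 0 * row_sum l 0)
      = 4 * ?T"
    unfolding sum_distrib_left
    by (subst sum_pf_coeff_even) (auto simp: row_sum_0_odd zeta intro!: sum.cong, simp add: algebra_simps)
  finally have "- ?C = 4 * (?zz - 1 / 2 * ?z - ?T)"
    using assms zeta[of p] zeta[of q] zeta[of "p + q"] unfolding pq by (simp add: algebra_simps)
  hence "- ?C / ?t = 4 / ?t * (?zz - 1 / 2 * ?z - ?T)" by simp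
  thus ?thesis unfolding double by simp
qed

theorem theorem1p1:
  fixes p q :: nat
  assumes "p \<ge> 1" and "q \<ge> 1"
  shows "(\<forall>\<tau>\<in>upper_half_plane.
      double_G (2 * p) (2 * q) \<tau> =
        eisenstein_G (2 * (p + q)) \<tau>
        + (\<Sum>(l\<^sub>1, l\<^sub>2)\<in>{(l\<^sub>1, l\<^sub>2). l\<^sub>1 \<ge> 1 \<and> l\<^sub>2 \<ge> 1 \<and> l\<^sub>1 + l\<^sub>2 = p + q}.
            2 * zeta_at (2 * l\<^sub>2) * of_nat ((2 * l\<^sub>2 - 1) choose (2 * q - 1)) / \<tau> ^ (2 * l\<^sub>2)
              * eisenstein_G (2 * l\<^sub>1) \<tau>
            + 2 * zeta_at (2 * l\<^sub>1) * of_nat ((2 * l\<^sub>1 - 1) choose (2 * p - 1)) / \<tau> ^ (2 * l\<^sub>1)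
              * eisenstein_G (2 * l\<^sub>2) \<tau>)
        + 4 / \<tau> ^ (2 * (p + q)) *
          (zeta_at (2 * p) * zeta_at (2 * q) - 1 / 2 * zeta_at (2 * (p + q))
           - (\<Sum>(l\<^sub>1, l\<^sub>2)\<in>{(l\<^sub>1, l\<^sub>2). l\<^sub>1 \<ge> 1 \<and> l\<^sub>2 \<ge> 1 \<and> l\<^sub>1 + l\<^sub>2 = p + q}.
               zeta_at (2 * l\<^sub>1) * zeta_at (2 * l\<^sub>2)
               * (of_nat ((2 * l\<^sub>2 - 1) choose (2 * q - 1))
                  + of_nat ((2 * l\<^sub>1 - 1) choose (2 * p - 1))))))
    \<and> (\<lambda>\<tau>. \<tau> ^ (2 * (p + q)) * double_G (2 * p) (2 * q) \<tau>)
        \<in> rat_polys_on upper_half_plane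
            {\<lambda>\<tau>. \<tau> ^ 2, \<lambda>\<tau>. of_real pi ^ 2, eisenstein_G 2, eisenstein_G 4, eisenstein_G 6}"
proof (rule conjI, goal_cases)
  case 1
  show ?case by (intro ballI double_G_formula assms) (simp add: upper_half_plane_def)
next
  case 2
  let ?A = "{\<lambda>\<tau>. \<tau> ^ 2, \<lambda>\<tau>. of_real pi ^ 2, eisenstein_G 2, eisenstein_G 4, eisenstein_G 6}"
  let ?N = "2 * p + 2 * q"
  \<comment> \<open>This uses the constant term in its binomial form from
    \<open>double_G_rows\<close>; only even powers of \<open>\<tau>\<close> remain, written as
    powers of \<open>\<tau> ^ 2\<close>.\<close>
  let ?f = "\<lambda>\<tau>. (\<tau> ^ 2) ^ (p + q) * eisenstein_G ?N \<tau>
      + (\<Sum>l\<in>{1..<p + q}. pf_coeff (2 * p) (2 * q) (2 * l) * row_sum (?N - 2 * l) 0 * (\<tau> ^ 2) ^ l * eisenstein_G (2 * l) \<tau>)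
      - of_nat (?N choose (2 * p)) * row_sum ?N 0"
  have G: "eisenstein_G (2 * l) \<in> rat_polys_on upper_half_plane ?A" if "l \<ge> 1" for l
  proof (cases "l = 1")
    case True
    thus ?thesis by (auto intro: rat_polys_on_gen)
  next
    case False
    thus ?thesis using that by (intro eisenstein_G_rat_poly) auto
  qed
  have "?f \<in> rat_polys_on upper_half_plane ?A"
    using assms G[of "p + q"]
    by (intro rat_polys_on_diff rat_polys_on_add rat_polys_on_sum rat_polys_on_mult rat_polys_on_power
        row_sum_0_rat_poly G rat_polys_on_gen[of "\<lambda>\<tau>. \<tau> ^ 2"] rat_polys_on_Rats pf_coeff_Rats)
      (auto simp: distrib_left)
  thus "(\<lambda>\<tau>. \<tau> ^ (2 * (p + q)) * double_G (2 * p) (2 * q) \<tau>) \<in> rat_polys_on upper_half_plane ?A"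
  proof (rule rat_polys_on_cong)
    fix \<tau> assume "\<tau> \<in> upper_half_plane"
    hence tau: "Im \<tau> > 0" "\<tau> \<noteq> 0" by (auto simp: upper_half_plane_def)
    let ?g = "\<lambda>l. pf_coeff (2 * p) (2 * q) l * row_sum (?N - l) 0 * \<tau> ^ l * eisenstein_G l \<tau>"
    have "\<tau> ^ ?N * double_G (2 * p) (2 * q) \<tau> = \<tau> ^ ?N * eisenstein_G ?N \<tau>
      + (\<Sum>l\<in>{2..<?N - 1}. \<tau> ^ ?N * (pf_coeff (2 * p) (2 * q) l * row_sum (?N - l) 0 / \<tau> ^ (?N - l) * eisenstein_G l \<tau>))
      - of_nat (?N choose (2 * p)) * row_sum ?N 0"
      using double_G_rows[OF tau(1), of "2 * p" "2 * q"] assms tau(2)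
      by (simp add: distrib_left right_diff_distrib sum_distrib_left)
    \<comment> \<open>Multiplication by \<open>\<tau> ^ ?N\<close> leaves \<open>\<tau> ^ l\<close>,
      and the terms with odd \<open>l\<close> vanish together with
      \<open>row_sum (?N - l) 0\<close>.\<close>
    also have "(\<Sum>l\<in>{2..<?N - 1}. \<tau> ^ ?N * (pf_coeff (2 * p) (2 * q) l * row_sum (?N - l) 0 / \<tau> ^ (?N - l) * eisenstein_G l \<tau>))
        = (\<Sum>l\<in>{2..<?N - 1}. if even l then ?g l else 0)"
    proof (rule sum.cong[OF refl])
      fix l assume l: "l \<in> {2..<?N - 1}"
      hence "l < ?N - 1" by simp
      hence "?N = (?N - l) + l" by linarith
      hence "\<tau> ^ ?N = \<tau> ^ (?N - l) * \<tau> ^ l" by (metis power_add)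
      moreover have "row_sum (?N - l) 0 = 0" if "odd l" using l that by (intro row_sum_0_odd) auto
      ultimately show "\<tau> ^ ?N * (pf_coeff (2 * p) (2 * q) l * row_sum (?N - l) 0 / \<tau> ^ (?N - l) * eisenstein_G l \<tau>)
          = (if even l then ?g l else 0)" using tau(2) by auto
    qed
    also have "\<dots> = (\<Sum>l\<in>{1..<p + q}. ?g (2 * l))"
      using sum_even_indices[of "\<lambda>l. if even l then ?g l else 0" "p + q"] by (simp add: distrib_left)
    finally show "?f \<tau> = \<tau> ^ (2 * (p + q)) * double_G (2 * p) (2 * q) \<tau>"
      by (simp add: power_mult[symmetric] distrib_left)
  qed
qed

end
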